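(* Let $p$ be a prime, let $G$ be a linear algebraic group over $\mathbb Q_p$, and let $g\in G(\mathbb Q_p)$. Then the following are equivalent: (i) $g$ has a $k$-th root in $G(\mathbb Q_p)$ for all $k\in\mathbb N$ (i.e. for every $k\in\mathbb N$ there is $h\in G(\mathbb Q_p)$ with $h^k=g$); (ii) $g$ is unipotent in $G(\mathbb Q_p)$; (iii) $g$ is contained in a one-parameter subgroup in $G(\mathbb Q_p)$.
   Context: A one-parameter subgroup in $G(\mathbb Q_p)$ is a continuous group homomorphism $\Phi:\mathbb Q_p\to G(\mathbb Q_p)$, where $\mathbb Q_p$ is regarded as an additive topological group and $G(\mathbb Q_p)$ carries its $p$-adic topology; $g$ is contained in it if $g\in\Phi(\mathbb Q_p)$. *)

theory Defs
  imports
    "HOL-Analysis.Analysis"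
    "HOL-Library.Poly_Mapping"
    "HOL-Algebra.Algebraic_Closure_Type"
    "Berlekamp_Zassenhaus.Finite_Field"
begin

no_notation fps_nth (infixl \<open>$\<close> 75)

section \<open>The field of \<open>p\<close>-adic numbers\<close>

definition padic_rat_abs :: "nat \<Rightarrow> rat \<Rightarrow> real" where
  "padic_rat_abs p q =
     (if q = 0 then 0
      else real p powi (int (multiplicity (int p) (snd (quotient_of q)))
                        - int (multiplicity (int p) (fst (quotient_of q)))))"

definition padic_Cauchy :: "nat \<Rightarrow> (nat \<Rightarrow> rat) \<Rightarrow> bool" where
  "padic_Cauchy p S \<longleftrightarrow>
     (\<forall>e>0. \<exists>N. \<forall>m\<ge>N. \<forall>n\<ge>N. padic_rat_abs p (S m - S n) < e)"

definition padic_null :: "nat \<Rightarrow> (nat \<Rightarrow> rat) \<Rightarrow> bool" where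
  "padic_null p S \<longleftrightarrow> (\<lambda>n. padic_rat_abs p (S n)) \<longlonglongrightarrow> 0"

definition padic_eqv :: "nat \<Rightarrow> (nat \<Rightarrow> rat) \<Rightarrow> (nat \<Rightarrow> rat) \<Rightarrow> bool" where
  "padic_eqv p S T \<longleftrightarrow>
     padic_Cauchy p S \<and> padic_Cauchy p T \<and> padic_null p (\<lambda>n. S n - T n)"

lemma padic_rat_abs_0 [simp]: "padic_rat_abs p 0 = 0"
  by (simp add: padic_rat_abs_def)

context
  fixes p :: nat
  assumes p: "Factorial_Ring.prime p"
begin

lemma padic_rat_abs_fraction:
  assumes "a \<noteq> 0" "b \<noteq> 0"
  shows "padic_rat_abs p (of_int a / of_int b) =
           real p powi (int (multiplicity (int p) b) - int (multiplicity (int p) a))"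
proof -
  obtain c d where cd: "quotient_of (of_int a / of_int b) = (c, d)"
    by (cases "quotient_of (of_int a / of_int b)")
  have d: "d > 0" using quotient_of_denom_pos[OF cd] .
  have eq: "(of_int a / of_int b :: rat) = of_int c / of_int d"
    using quotient_of_div[OF cd] .
  hence "(of_int (a * d) :: rat) = of_int (c * b)"
    using assms d by (simp add: field_simps)
  hence *: "a * d = c * b" by (simp only: of_int_eq_iff)
  have c: "c \<noteq> 0" using * assms d by auto
  have pe: "prime_elem (int p)" using p by simp
  have "multiplicity (int p) a + multiplicity (int p) d
      = multiplicity (int p) c + multiplicity (int p) b"
    using arg_cong[OF *, of "multiplicity (int p)"] assms c d pe
    by (simp add: prime_elem_multiplicity_mult_distrib)
  hence "int (multiplicity (int p) b) - int (multiplicity (int p) a)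
      = int (multiplicity (int p) d) - int (multiplicity (int p) c)"
    by linarith
  moreover have "(of_int a / of_int b :: rat) \<noteq> 0" using assms by simp
  ultimately show ?thesis by (simp add: padic_rat_abs_def cd)
qed

lemma rat_common_denom:
  obtains a b c where "(b::int) \<noteq> 0" "(x::rat) = of_int a / of_int b" "(y::rat) = of_int c / of_int b"
proof -
  obtain a1 b1 where x: "quotient_of x = (a1, b1)" by (cases "quotient_of x")
  obtain a2 b2 where y: "quotient_of y = (a2, b2)" by (cases "quotient_of y")
  have "b1 > 0" "b2 > 0" using quotient_of_denom_pos x y by auto
  moreover have "x = of_int a1 / of_int b1" "y = of_int a2 / of_int b2"
    using quotient_of_div x y by auto
  ultimately have "b1 * b2 \<noteq> 0" "x = of_int (a1 * b2) / of_int (b1 * b2)"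
      "y = of_int (a2 * b1) / of_int (b1 * b2)"
    by (auto simp: field_simps)
  thus ?thesis using that by blast
qed

lemma padic_rat_abs_pos: "x \<noteq> 0 \<Longrightarrow> padic_rat_abs p x > 0"
  using prime_gt_0_nat[OF p] by (simp add: padic_rat_abs_def)

lemma padic_rat_abs_nonneg [simp]: "padic_rat_abs p x \<ge> 0"
  using padic_rat_abs_pos[of x] by (cases "x = 0") auto

lemma padic_rat_abs_eq_0_iff [simp]: "padic_rat_abs p x = 0 \<longleftrightarrow> x = 0"
  using padic_rat_abs_pos[of x] by (cases "x = 0") auto

lemma padic_rat_abs_mult: "padic_rat_abs p (x * y) = padic_rat_abs p x * padic_rat_abs p y"
proof (cases "x = 0 \<or> y = 0")
  case False
  obtain a b c where b: "b \<noteq> 0" and x: "x = of_int a / of_int b" and y: "y = of_int c / of_int b"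
    by (rule rat_common_denom)
  have ac: "a \<noteq> 0" "c \<noteq> 0" using False x y by auto
  have xy: "x * y = of_int (a * c) / of_int (b * b)" using x y by simp
  have pe: "prime_elem (int p)" using p by simp
  have p0: "real p \<noteq> 0" using prime_gt_0_nat[OF p] by simp
  have "padic_rat_abs p (x * y) = real p powi
     (int (multiplicity (int p) (b * b)) - int (multiplicity (int p) (a * c)))"
    unfolding xy using ac b by (intro padic_rat_abs_fraction) auto
  also have "\<dots> = real p powi ((int (multiplicity (int p) b) - int (multiplicity (int p) a))
       + (int (multiplicity (int p) b) - int (multiplicity (int p) c)))"
    using ac b pe by (simp add: prime_elem_multiplicity_mult_distrib algebra_simps)
  also have "\<dots> = padic_rat_abs p x * padic_rat_abs p y"
    unfolding x y padic_rat_abs_fraction[OF ac(1) b] padic_rat_abs_fraction[OF ac(2) b]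
    by (rule power_int_add) (use p0 in simp)
  finally show ?thesis .
qed auto

lemma padic_rat_abs_1 [simp]: "padic_rat_abs p 1 = 1"
  by (simp add: padic_rat_abs_def)

lemma padic_rat_abs_minus [simp]: "padic_rat_abs p (- x) = padic_rat_abs p x"
proof -
  have "padic_rat_abs p (-1) * padic_rat_abs p (-1) = 1"
    by (simp flip: padic_rat_abs_mult)
  hence "padic_rat_abs p (-1) = 1"
    using padic_rat_abs_nonneg[of "-1"] by (simp add: square_eq_1_iff)
  thus ?thesis using padic_rat_abs_mult[of "-1" x] by simp
qed

lemma padic_rat_abs_diff_commute: "padic_rat_abs p (x - y) = padic_rat_abs p (y - x)"
  using padic_rat_abs_minus[of "x - y"] by simp

lemma padic_rat_abs_inverse: "padic_rat_abs p (inverse x) = inverse (padic_rat_abs p x)"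
proof (cases "x = 0")
  case False
  hence "padic_rat_abs p x * padic_rat_abs p (inverse x) = 1"
    by (simp flip: padic_rat_abs_mult)
  thus ?thesis by (metis inverse_unique)
qed auto

lemma padic_rat_abs_ultra: "padic_rat_abs p (x + y) \<le> max (padic_rat_abs p x) (padic_rat_abs p y)"
proof (cases "x = 0 \<or> y = 0 \<or> x + y = 0")
  case False
  obtain a b c where b: "b \<noteq> 0" and x: "x = of_int a / of_int b" and y: "y = of_int c / of_int b"
    by (rule rat_common_denom)
  have ac: "a \<noteq> 0" "c \<noteq> 0" using False x y by auto
  have xy: "x + y = of_int (a + c) / of_int b" using x y by (simp add: add_divide_distrib)
  have ac': "a + c \<noteq> 0" using False xy by auto
  have nu: "\<not> is_unit (int p)" using p not_prime_unit by auto
  define m where "m = min (multiplicity (int p) a) (multiplicity (int p) c)"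
  have "int p ^ m dvd a + c"
    by (intro dvd_add multiplicity_dvd') (auto simp: m_def)
  hence le: "m \<le> multiplicity (int p) (a + c)"
    using ac' nu by (intro multiplicity_geI) auto
  have p1: "real p \<ge> 1" using prime_ge_1_nat[OF p] by simp
  have "padic_rat_abs p (x + y)
      = real p powi (int (multiplicity (int p) b) - int (multiplicity (int p) (a + c)))"
    unfolding xy using ac' b by (rule padic_rat_abs_fraction)
  also have "\<dots> \<le> real p powi (int (multiplicity (int p) b) - int m)"
    using le p1 by (intro power_int_increasing) auto
  also have "\<dots> \<le> max (padic_rat_abs p x) (padic_rat_abs p y)"
    unfolding x y using ac b by (auto simp: padic_rat_abs_fraction m_def min_def)
  finally show ?thesis .
qed (auto simp: max_def)

lemma padic_rat_abs_triangle: "padic_rat_abs p (x + y) \<le> padic_rat_abs p x + padic_rat_abs p y"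
  using padic_rat_abs_ultra[of x y] padic_rat_abs_nonneg[of x] padic_rat_abs_nonneg[of y]
  by linarith

lemma padic_rat_abs_diff_bound:
  "\<bar>padic_rat_abs p x - padic_rat_abs p y\<bar> \<le> padic_rat_abs p (x - y)"
  using padic_rat_abs_triangle[of "x - y" y] padic_rat_abs_triangle[of "y - x" x]
    padic_rat_abs_diff_commute[of x y] by auto

lemma padic_rat_abs_isosceles:
  assumes "padic_rat_abs p (x - y) < padic_rat_abs p y"
  shows "padic_rat_abs p x = padic_rat_abs p y"
  using padic_rat_abs_ultra[of "x - y" y] padic_rat_abs_ultra[of "y - x" x] assms
    padic_rat_abs_diff_commute[of x y] by auto

lemma padic_CauchyD:
  assumes "padic_Cauchy p S" "e > 0"
  obtains N where "\<And>m n. m \<ge> N \<Longrightarrow> n \<ge> N \<Longrightarrow> padic_rat_abs p (S m - S n) < e"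
  using assms unfolding padic_Cauchy_def by blast

lemma padic_Cauchy_abs_convergent:
  assumes "padic_Cauchy p S"
  shows "convergent (\<lambda>n. padic_rat_abs p (S n))"
proof (rule Cauchy_convergent, rule metric_CauchyI)
  fix e :: real assume "e > 0"
  then obtain N where "\<And>m n. m \<ge> N \<Longrightarrow> n \<ge> N \<Longrightarrow> padic_rat_abs p (S m - S n) < e"
    using padic_CauchyD[OF assms] by blast
  thus "\<exists>M. \<forall>m\<ge>M. \<forall>n\<ge>M. dist (padic_rat_abs p (S m)) (padic_rat_abs p (S n)) < e"
    by (intro exI[of _ N]) (auto simp: dist_real_def intro: le_less_trans[OF padic_rat_abs_diff_bound])
qed

lemma padic_Cauchy_bounded:
  assumes "padic_Cauchy p S"
  obtains B where "B > 0" "\<And>n. padic_rat_abs p (S n) \<le> B"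
proof -
  have "Bseq (\<lambda>n. padic_rat_abs p (S n))"
    by (rule convergent_imp_Bseq[OF padic_Cauchy_abs_convergent[OF assms]])
  then obtain B where "B > 0" "\<And>n. norm (padic_rat_abs p (S n)) \<le> B"
    unfolding Bseq_def by blast
  thus ?thesis using that by auto
qed

lemma padic_Cauchy_const: "padic_Cauchy p (\<lambda>_. c)"
  by (simp add: padic_Cauchy_def)

lemma padic_Cauchy_add:
  assumes "padic_Cauchy p S" "padic_Cauchy p T"
  shows "padic_Cauchy p (\<lambda>n. S n + T n)"
  unfolding padic_Cauchy_def
proof (intro allI impI)
  fix e :: real assume e: "e > 0"
  obtain N where N: "\<And>m n. m \<ge> N \<Longrightarrow> n \<ge> N \<Longrightarrow> padic_rat_abs p (S m - S n) < e"
    using padic_CauchyD[OF assms(1) e] by blast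
  obtain M where M: "\<And>m n. m \<ge> M \<Longrightarrow> n \<ge> M \<Longrightarrow> padic_rat_abs p (T m - T n) < e"
    using padic_CauchyD[OF assms(2) e] by blast
  have "padic_rat_abs p (S m + T m - (S n + T n)) < e" if "m \<ge> max N M" "n \<ge> max N M" for m n
    using padic_rat_abs_ultra[of "S m - S n" "T m - T n"] N[of m n] M[of m n] that
    by (simp add: algebra_simps)
  thus "\<exists>N. \<forall>m\<ge>N. \<forall>n\<ge>N. padic_rat_abs p (S m + T m - (S n + T n)) < e" by blast
qed

lemma padic_Cauchy_minus:
  assumes "padic_Cauchy p S"
  shows "padic_Cauchy p (\<lambda>n. - S n)"
proof -
  have "padic_rat_abs p (- S m - - S n) = padic_rat_abs p (S m - S n)" for m n
    using padic_rat_abs_minus[of "S m - S n"] by simp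
  thus ?thesis using assms by (simp add: padic_Cauchy_def)
qed

lemma padic_Cauchy_mult:
  assumes "padic_Cauchy p S" "padic_Cauchy p T"
  shows "padic_Cauchy p (\<lambda>n. S n * T n)"
  unfolding padic_Cauchy_def
proof (intro allI impI)
  fix e :: real assume e: "e > 0"
  obtain A where A: "A > 0" "\<And>n. padic_rat_abs p (S n) \<le> A"
    using padic_Cauchy_bounded[OF assms(1)] by blast
  obtain B where B: "B > 0" "\<And>n. padic_rat_abs p (T n) \<le> B"
    using padic_Cauchy_bounded[OF assms(2)] by blast
  obtain N where N: "\<And>m n. m \<ge> N \<Longrightarrow> n \<ge> N \<Longrightarrow> padic_rat_abs p (S m - S n) < e / B"
    using padic_CauchyD[OF assms(1)] e B(1) by (metis divide_pos_pos)
  obtain M where M: "\<And>m n. m \<ge> M \<Longrightarrow> n \<ge> M \<Longrightarrow> padic_rat_abs p (T m - T n) < e / A"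
    using padic_CauchyD[OF assms(2)] e A(1) by (metis divide_pos_pos)
  have "padic_rat_abs p (S m * T m - S n * T n) < e" if "m \<ge> max N M" "n \<ge> max N M" for m n
  proof -
    have "S m * T m - S n * T n = S m * (T m - T n) + (S m - S n) * T n"
      by (simp add: algebra_simps)
    hence "padic_rat_abs p (S m * T m - S n * T n)
        \<le> max (padic_rat_abs p (S m) * padic_rat_abs p (T m - T n))
              (padic_rat_abs p (S m - S n) * padic_rat_abs p (T n))"
      using padic_rat_abs_ultra by (metis padic_rat_abs_mult)
    also have "\<dots> \<le> max (A * padic_rat_abs p (T m - T n)) (padic_rat_abs p (S m - S n) * B)"
      by (intro max.mono mult_right_mono mult_left_mono A B padic_rat_abs_nonneg)
    also have "\<dots> < e"
      using N[of m n] M[of m n] that A(1) B(1) by (simp add: field_simps)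
    finally show ?thesis .
  qed
  thus "\<exists>N. \<forall>m\<ge>N. \<forall>n\<ge>N. padic_rat_abs p (S m * T m - S n * T n) < e" by blast
qed

lemma padic_null_add:
  assumes "padic_null p S" "padic_null p T"
  shows "padic_null p (\<lambda>n. S n + T n)"
  unfolding padic_null_def
proof (rule tendsto_sandwich[OF _ _ tendsto_const])
  show "(\<lambda>n. padic_rat_abs p (S n) + padic_rat_abs p (T n)) \<longlonglongrightarrow> 0"
    using tendsto_add[OF assms[unfolded padic_null_def]] by simp
qed (auto simp: padic_rat_abs_triangle)

lemma padic_null_minus: "padic_null p S \<Longrightarrow> padic_null p (\<lambda>n. - S n)"
  by (simp add: padic_null_def)

lemma padic_null_mult:
  assumes "padic_null p S" "padic_Cauchy p T"
  shows "padic_null p (\<lambda>n. S n * T n)"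
proof -
  obtain B where B: "B > 0" "\<And>n. padic_rat_abs p (T n) \<le> B"
    using padic_Cauchy_bounded[OF assms(2)] by blast
  have lim: "(\<lambda>n. padic_rat_abs p (S n) * B) \<longlonglongrightarrow> 0"
    using tendsto_mult_right[OF assms(1)[unfolded padic_null_def], of B] by simp
  have ev: "\<forall>\<^sub>F n in sequentially. padic_rat_abs p (S n * T n) \<le> padic_rat_abs p (S n) * B"
    using B by (intro always_eventually allI) (simp add: padic_rat_abs_mult mult_left_mono)
  show ?thesis
    unfolding padic_null_def
    by (rule tendsto_sandwich[OF _ ev tendsto_const lim]) simp
qed

lemma padic_null_0 [simp]: "padic_null p (\<lambda>_. 0)"
  by (simp add: padic_null_def)

lemma padic_eqv_null_iff:
  assumes "padic_eqv p S T"
  shows "padic_null p S \<longleftrightarrow> padic_null p T"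
proof
  have n: "padic_null p (\<lambda>n. S n - T n)" using assms by (simp add: padic_eqv_def)
  show "padic_null p T" if "padic_null p S"
    using padic_null_add[OF that padic_null_minus[OF n]] by simp
  show "padic_null p S" if "padic_null p T"
    using padic_null_add[OF that n] by simp
qed

text \<open>By the ultrametric inequality, absolute values along a non-null Cauchy sequence are
  eventually constant.\<close>

lemma padic_nonnull_eventually_const:
  assumes "padic_Cauchy p S" "\<not> padic_null p S"
  obtains r N where "r > 0" "\<And>n. n \<ge> N \<Longrightarrow> padic_rat_abs p (S n) = r"
proof -
  obtain e where e: "e > 0" "\<And>N. \<exists>n\<ge>N. padic_rat_abs p (S n) \<ge> e"
    using assms(2) unfolding padic_null_def LIMSEQ_iff by (auto simp: not_less)
  obtain N where N: "\<And>m n. m \<ge> N \<Longrightarrow> n \<ge> N \<Longrightarrow> padic_rat_abs p (S m - S n) < e"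
    using padic_CauchyD[OF assms(1) e(1)] by blast
  obtain k where k: "k \<ge> N" "padic_rat_abs p (S k) \<ge> e" using e(2) by blast
  have "padic_rat_abs p (S n) = padic_rat_abs p (S k)" if "n \<ge> N" for n
    using N[OF that k(1)] k(2) by (intro padic_rat_abs_isosceles) auto
  thus ?thesis using that[of "padic_rat_abs p (S k)" N] e(1) k(2) by auto
qed

lemma padic_Cauchy_inverse:
  assumes "padic_Cauchy p S" "\<not> padic_null p S"
  shows "padic_Cauchy p (\<lambda>n. inverse (S n))"
  unfolding padic_Cauchy_def
proof (intro allI impI)
  fix e :: real assume e: "e > 0"
  obtain r M where r: "r > 0" "\<And>n. n \<ge> M \<Longrightarrow> padic_rat_abs p (S n) = r"
    using padic_nonnull_eventually_const[OF assms] by blast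
  have "e * r * r > 0" using e r(1) by simp
  then obtain N where N: "\<And>m n. m \<ge> N \<Longrightarrow> n \<ge> N \<Longrightarrow> padic_rat_abs p (S m - S n) < e * r * r"
    using padic_CauchyD[OF assms(1)] by blast
  have "padic_rat_abs p (inverse (S m) - inverse (S n)) < e"
    if "m \<ge> max N M" "n \<ge> max N M" for m n
  proof -
    have nz: "S m \<noteq> 0" "S n \<noteq> 0" using r that by fastforce+
    have "inverse (S m) - inverse (S n) = (S n - S m) * (inverse (S m) * inverse (S n))"
      using nz by (simp add: field_simps)
    hence "padic_rat_abs p (inverse (S m) - inverse (S n))
        = padic_rat_abs p (S n - S m) * (inverse r * inverse r)"
      using r(2) that by (simp add: padic_rat_abs_mult padic_rat_abs_inverse)
    also have "\<dots> < e"
      using N[of n m] that r(1) by (simp add: field_simps)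
    finally show ?thesis .
  qed
  thus "\<exists>N. \<forall>m\<ge>N. \<forall>n\<ge>N. padic_rat_abs p (inverse (S m) - inverse (S n)) < e" by blast
qed

lemma padic_eventually_nonzero:
  assumes "padic_Cauchy p S" "\<not> padic_null p S"
  shows "\<forall>\<^sub>F n in sequentially. S n \<noteq> 0"
proof -
  obtain r N where "r > 0" "\<And>n. n \<ge> N \<Longrightarrow> padic_rat_abs p (S n) = r"
    using padic_nonnull_eventually_const[OF assms] by blast
  thus ?thesis unfolding eventually_sequentially by fastforce
qed

lemma padic_null_cong:
  assumes "\<forall>\<^sub>F n in sequentially. S n = T n"
  shows "padic_null p S \<longleftrightarrow> padic_null p T"
  unfolding padic_null_def
  by (rule tendsto_cong, rule eventually_mono[OF assms]) simp

lemma padic_eqv_add: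
  assumes "padic_eqv p S S'" "padic_eqv p T T'"
  shows "padic_eqv p (\<lambda>n. S n + T n) (\<lambda>n. S' n + T' n)"
  using assms padic_null_add[of "\<lambda>n. S n - S' n" "\<lambda>n. T n - T' n"]
  by (auto simp: padic_eqv_def padic_Cauchy_add algebra_simps)

lemma padic_eqv_minus:
  assumes "padic_eqv p S S'"
  shows "padic_eqv p (\<lambda>n. - S n) (\<lambda>n. - S' n)"
  using assms padic_null_minus[of "\<lambda>n. S n - S' n"]
  by (auto simp: padic_eqv_def padic_Cauchy_minus)

lemma padic_eqv_mult:
  assumes "padic_eqv p S S'" "padic_eqv p T T'"
  shows "padic_eqv p (\<lambda>n. S n * T n) (\<lambda>n. S' n * T' n)"
proof -
  have "padic_null p (\<lambda>n. (S n - S' n) * T n + (T n - T' n) * S' n)"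
    using assms by (intro padic_null_add padic_null_mult) (auto simp: padic_eqv_def)
  also have "(\<lambda>n. (S n - S' n) * T n + (T n - T' n) * S' n) = (\<lambda>n. S n * T n - S' n * T' n)"
    by (auto simp: algebra_simps)
  finally show ?thesis
    using assms by (auto simp: padic_eqv_def padic_Cauchy_mult)
qed

lemma padic_eqv_inverse:
  assumes "padic_eqv p S T" "\<not> padic_null p S"
  shows "padic_eqv p (\<lambda>n. inverse (S n)) (\<lambda>n. inverse (T n))"
proof -
  have C: "padic_Cauchy p S" "padic_Cauchy p T" and n: "padic_null p (\<lambda>n. S n - T n)"
    using assms by (auto simp: padic_eqv_def)
  have T: "\<not> padic_null p T" using padic_eqv_null_iff assms by blast
  have C': "padic_Cauchy p (\<lambda>n. inverse (S n))" "padic_Cauchy p (\<lambda>n. inverse (T n))"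
    using padic_Cauchy_inverse C T assms by auto
  have "padic_null p (\<lambda>n. - (S n - T n) * (inverse (S n) * inverse (T n)))"
    by (intro padic_null_mult padic_null_minus n padic_Cauchy_mult C')
  also have "?this \<longleftrightarrow> padic_null p (\<lambda>n. inverse (S n) - inverse (T n))"
  proof (rule padic_null_cong)
    show "\<forall>\<^sub>F n in sequentially. - (S n - T n) * (inverse (S n) * inverse (T n))
             = inverse (S n) - inverse (T n)"
      using padic_eventually_nonzero[OF C(1) assms(2)] padic_eventually_nonzero[OF C(2) T]
      by eventually_elim (simp add: field_simps)
  qed
  finally show ?thesis using C' by (simp add: padic_eqv_def)
qed

lemma padic_eqv_refl_iff: "padic_eqv p S S \<longleftrightarrow> padic_Cauchy p S"
  by (auto simp: padic_eqv_def)

lemma padic_eqv_part_equivp: "part_equivp (padic_eqv p)"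
proof (rule part_equivpI)
  show "\<exists>S. padic_eqv p S S" using padic_eqv_refl_iff padic_Cauchy_const by blast
  show "symp (padic_eqv p)"
  proof (rule sympI)
    fix S T assume "padic_eqv p S T"
    thus "padic_eqv p T S"
      using padic_null_minus[of "\<lambda>n. S n - T n"] by (auto simp: padic_eqv_def)
  qed
  show "transp (padic_eqv p)"
  proof (rule transpI)
    fix S T Z assume "padic_eqv p S T" "padic_eqv p T Z"
    thus "padic_eqv p S Z"
      using padic_null_add[of "\<lambda>n. S n - T n" "\<lambda>n. T n - Z n"] by (auto simp: padic_eqv_def)
  qed
qed

lemma padic_eqv_lim_abs:
  assumes "padic_eqv p S T"
  shows "lim (\<lambda>n. padic_rat_abs p (S n)) = lim (\<lambda>n. padic_rat_abs p (T n))"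
proof -
  have "convergent (\<lambda>n. padic_rat_abs p (S n))" "convergent (\<lambda>n. padic_rat_abs p (T n))"
    using assms padic_Cauchy_abs_convergent by (auto simp: padic_eqv_def)
  hence S: "(\<lambda>n. padic_rat_abs p (S n)) \<longlonglongrightarrow> lim (\<lambda>n. padic_rat_abs p (S n))"
    and T: "(\<lambda>n. padic_rat_abs p (T n)) \<longlonglongrightarrow> lim (\<lambda>n. padic_rat_abs p (T n))"
    by (auto simp: convergent_LIMSEQ_iff)
  have "(\<lambda>n. \<bar>padic_rat_abs p (S n) - padic_rat_abs p (T n)\<bar>) \<longlonglongrightarrow> 0"
  proof (rule tendsto_sandwich[OF _ _ tendsto_const])
    show "(\<lambda>n. padic_rat_abs p (S n - T n)) \<longlonglongrightarrow> 0"
      using assms by (auto simp: padic_eqv_def padic_null_def)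
  qed (auto simp: padic_rat_abs_diff_bound)
  hence "(\<lambda>n. padic_rat_abs p (S n) - padic_rat_abs p (T n)) \<longlonglongrightarrow> 0"
    by (simp add: tendsto_rabs_zero_iff)
  with tendsto_diff[OF S T] show ?thesis
    using LIMSEQ_unique by fastforce
qed

end

text \<open>The prime is carried by the type: every prime is \<open>CARD('p)\<close> for some type \<open>'p\<close> in class
  \<open>prime_card\<close>. \<open>'p padic\<close> is \<open>\<rat>\<^sub>p\<close> for the prime \<open>p = CARD('p)\<close>: Cauchy sequences of rationals modulo null
  sequences, both with respect to the \<open>p\<close>-adic absolute value.\<close>

typedef 'p padic =
  "{{T. padic_eqv CARD('p::prime_card) S T} | S. padic_Cauchy CARD('p) S}"
  using padic_Cauchy_const[OF prime_card] by blast

definition padic_of_seq :: "(nat \<Rightarrow> rat) \<Rightarrow> 'p::prime_card padic" where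
  "padic_of_seq S = Abs_padic {T. padic_eqv CARD('p) S T}"

definition padic_rep_seq :: "'p::prime_card padic \<Rightarrow> nat \<Rightarrow> rat" where
  "padic_rep_seq x = (SOME S. S \<in> Rep_padic x)"

definition cr_padic :: "(nat \<Rightarrow> rat) \<Rightarrow> 'p::prime_card padic \<Rightarrow> bool" where
  "cr_padic = (\<lambda>S x. padic_eqv CARD('p) S S \<and> padic_of_seq S = x)"

lemma Quotient_padic:
  "Quotient (padic_eqv CARD('p)) padic_of_seq padic_rep_seq
     (cr_padic :: _ \<Rightarrow> 'p::prime_card padic \<Rightarrow> bool)"
proof (rule QuotientI)
  note sym = part_equivp_symp[OF padic_eqv_part_equivp[OF prime_card[where 'a='p]]]
  note trans = part_equivp_transp[OF padic_eqv_part_equivp[OF prime_card[where 'a='p]]]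
  note refl_iff = padic_eqv_refl_iff[OF prime_card[where 'a='p]]
  have rep: "padic_Cauchy CARD('p) (padic_rep_seq x)
      \<and> Rep_padic x = {T. padic_eqv CARD('p) (padic_rep_seq x) T}" for x :: "'p padic"
  proof -
    obtain S where S: "padic_Cauchy CARD('p) S" "Rep_padic x = {T. padic_eqv CARD('p) S T}"
      using Rep_padic[of x] by blast
    have "S \<in> Rep_padic x" using S by (simp add: refl_iff)
    hence "padic_rep_seq x \<in> Rep_padic x" unfolding padic_rep_seq_def by (rule Hilbert_Choice.someI[of "\<lambda>S. S \<in> Rep_padic x"])
    hence e: "padic_eqv CARD('p) S (padic_rep_seq x)" using S by simp
    hence "{T. padic_eqv CARD('p) S T} = {T. padic_eqv CARD('p) (padic_rep_seq x) T}"
      using sym trans by blast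
    thus ?thesis using e S(2) by (simp add: padic_eqv_def)
  qed
  show "padic_of_seq (padic_rep_seq x) = x" for x :: "'p padic"
    using rep[of x] by (metis padic_of_seq_def Rep_padic_inverse)
  show "padic_eqv CARD('p) (padic_rep_seq x) (padic_rep_seq x)" for x :: "'p padic"
    using rep[of x] by (simp add: refl_iff)
  define C where "C = (\<lambda>S. {T. padic_eqv CARD('p) S T})"
  have of_seq: "padic_of_seq S = (Abs_padic (C S) :: 'p padic)" for S
    by (simp add: padic_of_seq_def C_def)
  have mem: "C S \<in> {{T. padic_eqv CARD('p) S T} | S. padic_Cauchy CARD('p) S}"
    if "padic_eqv CARD('p) S S" for S
    unfolding C_def by (rule CollectI, rule exI[of _ S]) (use that in \<open>simp add: refl_iff\<close>)
  have C_eq: "padic_eqv CARD('p) S T \<longleftrightarrow> C S = C T"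
    if "padic_eqv CARD('p) S S" "padic_eqv CARD('p) T T" for S T
  proof
    show "C S = C T" if "padic_eqv CARD('p) S T"
      unfolding C_def using sym[OF that] trans[OF that] trans[OF sym[OF that]] by blast
    have "T \<in> C T" using that by (simp add: C_def)
    thus "padic_eqv CARD('p) S T" if "C S = C T"
      using that unfolding C_def by blast
  qed
  show "padic_eqv CARD('p) S T \<longleftrightarrow> padic_eqv CARD('p) S S \<and> padic_eqv CARD('p) T T
      \<and> (padic_of_seq S :: 'p padic) = padic_of_seq T" for S T
  proof (cases "padic_eqv CARD('p) S S \<and> padic_eqv CARD('p) T T")
    case True
    hence "(padic_of_seq S :: 'p padic) = padic_of_seq T \<longleftrightarrow> C S = C T"
      unfolding of_seq by (intro Abs_padic_inject mem) auto
    thus ?thesis using C_eq True by simp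
  next
    case False
    thus ?thesis by (auto simp: padic_eqv_def padic_null_0[OF prime_card])
  qed
  show "(cr_padic :: _ \<Rightarrow> 'p padic \<Rightarrow> bool) = (\<lambda>S x. padic_eqv CARD('p) S S \<and> padic_of_seq S = x)"
    by (rule cr_padic_def)
qed

setup_lifting Quotient_padic

instantiation padic :: (prime_card) field
begin

lift_definition zero_padic :: "'a padic" is "\<lambda>_. 0"
  by (simp add: padic_eqv_refl_iff padic_Cauchy_const prime_card)

lift_definition one_padic :: "'a padic" is "\<lambda>_. 1"
  by (simp add: padic_eqv_refl_iff padic_Cauchy_const prime_card)

lift_definition plus_padic :: "'a padic \<Rightarrow> 'a padic \<Rightarrow> 'a padic" is "\<lambda>S T n. S n + T n"
  by (rule padic_eqv_add[OF prime_card])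

lift_definition uminus_padic :: "'a padic \<Rightarrow> 'a padic" is "\<lambda>S n. - S n"
  by (rule padic_eqv_minus[OF prime_card])

lift_definition times_padic :: "'a padic \<Rightarrow> 'a padic \<Rightarrow> 'a padic" is "\<lambda>S T n. S n * T n"
  by (rule padic_eqv_mult[OF prime_card])

lift_definition inverse_padic :: "'a padic \<Rightarrow> 'a padic"
  is "\<lambda>S. if padic_null CARD('a) S then (\<lambda>_. 0) else (\<lambda>n. inverse (S n))"
  by (auto simp: padic_eqv_null_iff[OF prime_card] padic_eqv_inverse[OF prime_card]
      padic_eqv_refl_iff[OF prime_card] padic_Cauchy_const[OF prime_card]
      dest: padic_eqv_null_iff[OF prime_card])

definition "x - y = x + - y" for x y :: "'a padic"

definition "divide x y = x * inverse y" for x y :: "'a padic"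

lemma padic_eqv_of_eq:
  "padic_Cauchy CARD('a::prime_card) S \<Longrightarrow> S = T \<Longrightarrow> padic_eqv CARD('a) S T"
  by (simp add: padic_eqv_refl_iff prime_card)

instance
proof
  note [simp] = padic_eqv_refl_iff[OF prime_card]
  note [intro!] = padic_eqv_of_eq padic_Cauchy_add[OF prime_card] padic_Cauchy_mult[OF prime_card]
    padic_Cauchy_minus[OF prime_card] padic_Cauchy_const[OF prime_card]
  fix a b c :: "'a padic"
  show "a + b + c = a + (b + c)" by transfer (auto simp: algebra_simps)
  show "a + b = b + a" by transfer (auto simp: algebra_simps)
  show "0 + a = a" by transfer auto
  show "- a + a = 0" by transfer auto
  show "a - b = a + - b" by (simp add: minus_padic_def)
  show "a * b * c = a * (b * c)" by transfer (auto simp: algebra_simps)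
  show "a * b = b * a" by transfer (auto simp: algebra_simps)
  show "1 * a = a" by transfer auto
  show "(a + b) * c = a * c + b * c" by transfer (auto simp: algebra_simps)
  show "(0 :: 'a padic) \<noteq> 1"
    by transfer (simp add: padic_eqv_def padic_null_def padic_rat_abs_minus prime_card
        padic_rat_abs_1 LIMSEQ_const_iff)
  show "inverse a * a = 1" if "a \<noteq> 0" using that
  proof transfer
    fix S assume S: "padic_eqv CARD('a) S S" "\<not> padic_eqv CARD('a) S (\<lambda>_. 0)"
    hence C: "padic_Cauchy CARD('a) S" and n: "\<not> padic_null CARD('a) S"
      by (auto simp: padic_eqv_def padic_Cauchy_const[OF prime_card])
    have "padic_null CARD('a) (\<lambda>n. inverse (S n) * S n - 1) \<longleftrightarrow> padic_null CARD('a) (\<lambda>_. 0)"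
      by (rule padic_null_cong[OF prime_card],
          rule eventually_mono[OF padic_eventually_nonzero[OF prime_card C n]]) simp
    thus "padic_eqv CARD('a)
        (\<lambda>k. (if padic_null CARD('a) S then \<lambda>_. 0 else (\<lambda>n. inverse (S n))) k * S k) (\<lambda>_. 1)"
      using n C padic_Cauchy_inverse[OF prime_card C n]
      by (simp add: padic_eqv_def padic_null_0 prime_card padic_Cauchy_mult padic_Cauchy_const)
  qed
  show "a div b = a * inverse b" by (simp add: divide_padic_def)
  show "inverse (0 :: 'a padic) = 0"
    by transfer (simp add: padic_null_0 prime_card padic_Cauchy_const)
qed

end

lift_definition padic_abs :: "'p::prime_card padic \<Rightarrow> real"
  is "\<lambda>S. lim (\<lambda>n. padic_rat_abs CARD('p) (S n))"
  by (rule padic_eqv_lim_abs[OF prime_card])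

lemma padic_abs_0: "padic_abs 0 = 0"
  by transfer simp

lemma padic_rat_abs_tendsto_lim:
  fixes S :: "nat \<Rightarrow> rat"
  assumes "padic_eqv CARD('p::prime_card) S S"
  shows "(\<lambda>n. padic_rat_abs CARD('p) (S n)) \<longlonglongrightarrow> lim (\<lambda>n. padic_rat_abs CARD('p) (S n))"
  using assms padic_Cauchy_abs_convergent[OF prime_card[where 'a='p], of S]
  by (simp add: padic_eqv_refl_iff[OF prime_card] convergent_LIMSEQ_iff)

lemma padic_abs_eq_0D: "x = 0" if "padic_abs x = 0"
  using that
proof transfer
  fix S assume S: "padic_eqv CARD('a) S S" and l: "lim (\<lambda>n. padic_rat_abs CARD('a) (S n)) = 0"
  show "padic_eqv CARD('a) S (\<lambda>_. 0)"
    using S padic_rat_abs_tendsto_lim[OF S] l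
    by (auto simp: padic_eqv_def padic_null_def padic_Cauchy_const[OF prime_card])
qed

lemma padic_abs_minus: "padic_abs (- x) = padic_abs x"
  by transfer (simp add: padic_rat_abs_minus prime_card)

lemma padic_abs_triangle: "padic_abs (x + y) \<le> padic_abs x + padic_abs y"
proof transfer
  fix S T assume *: "padic_eqv CARD('a) S S" "padic_eqv CARD('a) T T"
  have XY: "padic_eqv CARD('a) (\<lambda>n. S n + T n) (\<lambda>n. S n + T n)"
    by (rule padic_eqv_add[OF prime_card *])
  show "lim (\<lambda>n. padic_rat_abs CARD('a) (S n + T n))
      \<le> lim (\<lambda>n. padic_rat_abs CARD('a) (S n)) + lim (\<lambda>n. padic_rat_abs CARD('a) (T n))"
    by (rule LIMSEQ_le[OF padic_rat_abs_tendsto_lim[OF XY]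
          tendsto_add[OF padic_rat_abs_tendsto_lim[OF *(1)] padic_rat_abs_tendsto_lim[OF *(2)]]])
       (auto simp: padic_rat_abs_triangle[OF prime_card])
qed

instantiation padic :: (prime_card) metric_space
begin

definition "dist x y = padic_abs (x - y)" for x y :: "'a padic"

definition uniformity_padic :: "('a padic \<times> 'a padic) filter"
  where "uniformity_padic = (INF e\<in>{0<..}. principal {(x, y). dist x y < e})"

definition open_padic :: "'a padic set \<Rightarrow> bool"
  where "open_padic U \<longleftrightarrow> (\<forall>x\<in>U. eventually (\<lambda>(x', y). x' = x \<longrightarrow> y \<in> U) uniformity)"

instance
proof
  fix x y z :: "'a padic"
  show "dist x y = 0 \<longleftrightarrow> x = y"
    using padic_abs_eq_0D[of "x - y"] by (auto simp: dist_padic_def padic_abs_0)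
  show "dist x y \<le> dist x z + dist y z"
    using padic_abs_triangle[of "x - z" "z - y"] padic_abs_minus[of "y - z"]
    by (simp add: dist_padic_def)
qed (auto simp: uniformity_padic_def open_padic_def)

end


section \<open>Linear algebraic groups\<close>

text \<open>Polynomials in the matrix entries \<open>x\<^sub>i\<^sub>j\<close>, with the pair \<open>(i, j)\<close> as the variable; a monomial
  is the finitely supported map of its exponents.\<close>

type_synonym ('k, 'n) entry_poly = "(('n \<times> 'n) \<Rightarrow>\<^sub>0 nat) \<Rightarrow>\<^sub>0 'k"

definition eval_entry_poly ::
    "('k::zero \<Rightarrow> 'l::comm_semiring_1) \<Rightarrow> 'l^'n^'n \<Rightarrow> ('k, 'n::finite) entry_poly \<Rightarrow> 'l" where
  "eval_entry_poly \<phi> A f =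
     (\<Sum>m\<in>Poly_Mapping.keys f. \<phi> (Poly_Mapping.lookup f m) *
        (\<Prod>(i, j)\<in>Poly_Mapping.keys m. (A $ i $ j) ^ Poly_Mapping.lookup m (i, j)))"

text \<open>On \<open>'a^'n^'n\<close> the class operations \<open>*\<close> and \<open>1\<close> are entrywise, hence the explicit monoid.\<close>

definition matrix_monoid :: "('a::semiring_1 ^ 'n ^ 'n) monoid" where
  "matrix_monoid = \<lparr>carrier = UNIV, mult = (**), one = mat 1\<rparr>"

definition GL :: "('a::semiring_1 ^ 'n ^ 'n) monoid" where
  "GL = \<lparr>carrier = {A. invertible A}, mult = (**), one = mat 1\<rparr>"

text \<open>The points, over an extension \<open>\<phi> : k \<rightarrow> l\<close>, of the closed subset of \<open>GL\<^sub>n\<close> cut out by a set of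
  polynomials over \<open>k\<close>.\<close>

definition points_over ::
    "('k::zero \<Rightarrow> 'l::comm_semiring_1) \<Rightarrow> ('k, 'n::finite) entry_poly set \<Rightarrow> ('l^'n^'n) set" where
  "points_over \<phi> P = {A. invertible A \<and> (\<forall>f\<in>P. eval_entry_poly \<phi> A f = 0)}"

text \<open>A linear algebraic group over \<open>k\<close> is a Zariski closed subgroup of \<open>GL\<^sub>n\<close> over the algebraic
  closure of \<open>k\<close> that is the zero locus of polynomials over \<open>k\<close>. For perfect \<open>k\<close>, such as \<open>\<rat>\<^sub>p\<close>,
  this is the same as being defined over \<open>k\<close>; for imperfect \<open>k\<close> it is weaker.\<close>

definition linear_algebraic_group :: "('k::field, 'n::finite) entry_poly set \<Rightarrow> bool" where
  "linear_algebraic_group P \<longleftrightarrow>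
     subgroup (points_over to_ac P) (GL :: ('k alg_closure ^ 'n ^ 'n) monoid)"

abbreviation rational_points :: "('k::field, 'n::finite) entry_poly set \<Rightarrow> ('k^'n^'n) set" where
  "rational_points P \<equiv> points_over (\<lambda>c. c) P"

text \<open>For \<open>A\<close> in a closed subgroup of \<open>GL\<^sub>n\<close>, unipotence does not depend on the embedding.\<close>

definition unipotent :: "'a::ring_1 ^ 'n ^ 'n \<Rightarrow> bool" where
  "unipotent A \<longleftrightarrow> (\<exists>m::nat. (A - mat 1) [^]\<^bsub>matrix_monoid\<^esub> m = 0)"

text \<open>\<open>'p padic ^ 'n ^ 'n\<close> carries the product topology of the \<open>p\<close>-adic topology on the entries, which
  induces the \<open>p\<close>-adic topology on the group of rational points.\<close>

definition one_parameter_subgroup ::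
    "('p::prime_card padic, 'n::finite) entry_poly set \<Rightarrow> ('p padic \<Rightarrow> 'p padic ^ 'n ^ 'n) \<Rightarrow> bool" where
  "one_parameter_subgroup P \<Phi> \<longleftrightarrow>
     continuous_on UNIV \<Phi> \<and> range \<Phi> \<subseteq> rational_points P \<and>
     (\<forall>s t. \<Phi> (s + t) = \<Phi> s ** \<Phi> t)"

end

theory Submission
  imports Defs
begin

text \<open>Write $p$ for the prime. Two of the three implications are elementary. A unipotent $g$ lies on the
  curve $t \mapsto \sum_j {t \choose j} (g - 1)^j$, a finite sum, which is a homomorphism by Vandermonde's
  identity; the equations of the group vanish along it because they are polynomial in $t$ and vanish at
  all natural numbers (\<open>one_parameter_subgroup_unipotent_power\<close>). And an element $\Phi(t)$ of a one-parameter
  subgroup has the $k$-th root $\Phi(t / k)$ (\<open>one_parameter_subgroup_of_nat\<close>).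

  The remaining implication is a statement about invertible matrices over \<open>\<rat>\<^sub>p\<close> (\<open>roots_imp_unipotent\<close>). The
  classical argument says that an eigenvalue of $g$ has roots of all orders in extensions of bounded
  degree of \<open>\<rat>\<^sub>p\<close>. Their value groups are uniformly discrete and their residue fields uniformly finite,
  which makes the eigenvalue first a unit, then a principal unit, then arbitrarily close to $1$. Here it is carried out without field extensions, by means of the
  minimal polynomial $f$ of a $k$-th root $h$ of $g$, whose degree is at most $n^2$.

  Discreteness of the value group shows that $f$ is integral once $k$ is large, because $f$ divides
  $G(x^k)$ for the fixed minimal polynomial $G$ of $g$ (\<open>integral_poly_of_dvd_pcompose_monom\<close>). Finiteness
  of the residue field shows that for suitable $k$, not depending on $f$, the power $x^k$ is idempotent
  modulo $p^{s+1}$ and $f$ (\<open>monom_power_idempotent_mod\<close>). Evaluating at $h$, the matrix $g^2 - g$ is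
  $p^{s+1}$ times an integral polynomial in $h$, whose powers are bounded. As $s$ is arbitrary, $g^2 - g$
  has spectral radius $0$ and is nilpotent (\<open>mat_nilpotentI\<close>), and so is $g - 1$.\<close>

hide_const (open) up_ring.coeff up_ring.monom module.smult Polynomials.lead_coeff
  Polynomials.degree

section \<open>The absolute value, the value group and the residue field\<close>

lemma padic_abs_tendsto:
  fixes S :: "nat \<Rightarrow> rat"
  assumes "padic_eqv CARD('p::prime_card) S S"
  shows "(\<lambda>n. padic_rat_abs CARD('p) (S n)) \<longlonglongrightarrow> padic_abs (padic_of_seq S :: 'p padic)"
proof -
  have "padic_abs (padic_of_seq S :: 'p padic) = lim (\<lambda>n. padic_rat_abs CARD('p) (S n))"
    using assms by (simp add: padic_abs.abs_eq)
  thus ?thesis using padic_rat_abs_tendsto_lim[OF assms] by simp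
qed

lemma padic_abs_mult: "padic_abs (x * y) = padic_abs x * padic_abs y"
proof transfer
  fix S T assume *: "padic_eqv CARD('a) S S" "padic_eqv CARD('a) T T"
  have ST: "padic_eqv CARD('a) (\<lambda>n. S n * T n) (\<lambda>n. S n * T n)"
    by (rule padic_eqv_mult[OF prime_card *])
  show "lim (\<lambda>n. padic_rat_abs CARD('a) (S n * T n))
      = lim (\<lambda>n. padic_rat_abs CARD('a) (S n)) * lim (\<lambda>n. padic_rat_abs CARD('a) (T n))"
    using LIMSEQ_unique[OF padic_rat_abs_tendsto_lim[OF ST]]
      tendsto_mult[OF padic_rat_abs_tendsto_lim[OF *(1)] padic_rat_abs_tendsto_lim[OF *(2)]]
    by (simp add: padic_rat_abs_mult[OF prime_card])
qed

lemma padic_abs_ultra: "padic_abs (x + y) \<le> max (padic_abs x) (padic_abs y)"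
proof transfer
  fix S T assume *: "padic_eqv CARD('a) S S" "padic_eqv CARD('a) T T"
  have ST: "padic_eqv CARD('a) (\<lambda>n. S n + T n) (\<lambda>n. S n + T n)"
    by (rule padic_eqv_add[OF prime_card *])
  show "lim (\<lambda>n. padic_rat_abs CARD('a) (S n + T n))
      \<le> max (lim (\<lambda>n. padic_rat_abs CARD('a) (S n))) (lim (\<lambda>n. padic_rat_abs CARD('a) (T n)))"
    by (rule LIMSEQ_le[OF padic_rat_abs_tendsto_lim[OF ST]
          tendsto_max[OF padic_rat_abs_tendsto_lim[OF *(1)] padic_rat_abs_tendsto_lim[OF *(2)]]])
       (auto simp: padic_rat_abs_ultra[OF prime_card])
qed

lemma padic_abs_nonneg [simp]: "padic_abs x \<ge> 0"
  using padic_abs_triangle[of x "-x"] by (simp add: padic_abs_minus padic_abs_0)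

lemma padic_abs_eq_0_iff [simp]: "padic_abs x = 0 \<longleftrightarrow> x = 0"
  using padic_abs_eq_0D padic_abs_0 by metis

lemma padic_abs_pos_iff [simp]: "padic_abs x > 0 \<longleftrightarrow> x \<noteq> 0"
  using padic_abs_nonneg[of x] padic_abs_eq_0_iff[of x] by linarith

lemma padic_abs_1 [simp]: "padic_abs 1 = 1"
  using padic_abs_mult[of 1 1] padic_abs_eq_0_iff[of 1] by simp

lemma padic_abs_power: "padic_abs (x ^ n) = padic_abs x ^ n"
  by (induction n) (auto simp: padic_abs_mult)

lemma padic_abs_diff_ultra: "padic_abs (x - y) \<le> max (padic_abs x) (padic_abs y)"
  using padic_abs_ultra[of x "-y"] by (simp add: padic_abs_minus)

lemma padic_abs_add_le: "padic_abs x \<le> c \<Longrightarrow> padic_abs y \<le> c \<Longrightarrow> padic_abs (x + y) \<le> c"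
  using padic_abs_ultra[of x y] by simp

lemma padic_abs_add_less: "padic_abs x < c \<Longrightarrow> padic_abs y < c \<Longrightarrow> padic_abs (x + y) < c"
  using padic_abs_ultra[of x y] by simp

lemma padic_abs_sum_le:
  assumes "\<And>i. i \<in> I \<Longrightarrow> padic_abs (f i) \<le> c" "c \<ge> 0"
  shows "padic_abs (sum f I) \<le> c"
  using assms by (induction I rule: infinite_finite_induct) (auto intro: padic_abs_add_le simp: padic_abs_0)

lemma padic_abs_sum_less:
  assumes "\<And>i. i \<in> I \<Longrightarrow> padic_abs (f i) < c" "c > 0"
  shows "padic_abs (sum f I) < c"
  using assms by (induction I rule: infinite_finite_induct) (auto intro: padic_abs_add_less simp: padic_abs_0)

lemma padic_abs_add_eq_left:
  assumes "padic_abs y < padic_abs x"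
  shows "padic_abs (x + y) = padic_abs x"
  using padic_abs_ultra[of x y] padic_abs_diff_ultra[of "x + y" y] assms by auto

lemma padic_abs_inverse: "padic_abs (inverse x) = inverse (padic_abs x)"
proof (cases "x = 0")
  case False
  hence "padic_abs x * padic_abs (inverse x) = 1" by (simp flip: padic_abs_mult)
  thus ?thesis by (metis inverse_unique)
qed (auto simp: padic_abs_0)

lemma padic_abs_divide: "padic_abs (x / y) = padic_abs x / padic_abs y"
  by (simp only: divide_inverse padic_abs_mult padic_abs_inverse)

text \<open>The rationals as constant Cauchy sequences. They are dense by construction of the completion, and
  their absolute value is explicit, so facts about the value group and the residue field are read off
  from them.\<close>

lift_definition padic_rat :: "rat \<Rightarrow> 'p::prime_card padic" is "\<lambda>q _. q"
  by (simp add: padic_eqv_refl_iff padic_Cauchy_const prime_card)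

lemma padic_abs_padic_rat: "padic_abs (padic_rat q :: 'p::prime_card padic) = padic_rat_abs CARD('p) q"
  by transfer simp

lemma padic_eqv_const: "padic_eqv CARD('p::prime_card) (\<lambda>_. c) (\<lambda>_. c)"
  by (simp add: padic_eqv_refl_iff padic_Cauchy_const prime_card)

lemma padic_rat_add: "padic_rat (a + b) = padic_rat a + padic_rat b"
  by transfer (rule padic_eqv_const)

lemma padic_rat_minus: "padic_rat (- a) = - padic_rat a"
  by transfer (rule padic_eqv_const)

lemma padic_rat_diff: "padic_rat (a - b) = padic_rat a - padic_rat b"
  using padic_rat_add[of a "-b"] by (simp add: padic_rat_minus)

lemma of_nat_eq_padic_rat: "of_nat n = padic_rat (of_nat n)"
proof (induction n)
  case 0
  show ?case by (simp, transfer, rule padic_eqv_const)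
next
  case (Suc n)
  have "(1 :: 'a padic) = padic_rat 1" by transfer (rule padic_eqv_const)
  thus ?case using Suc by (simp add: padic_rat_add)
qed

lemma padic_abs_of_nat:
  "padic_abs (of_nat n :: 'p::prime_card padic) = padic_rat_abs CARD('p) (of_nat n)"
  by (simp only: of_nat_eq_padic_rat padic_abs_padic_rat)

lemma padic_abs_of_nat_le_1: "padic_abs (of_nat n) \<le> 1"
  by (induction n) (auto simp: padic_abs_0 intro: padic_abs_add_le)

instance padic :: (prime_card) field_char_0
proof
  show "inj (of_nat :: nat \<Rightarrow> 'a padic)"
  proof (rule injI)
    fix m n :: nat assume "(of_nat m :: 'a padic) = of_nat n"
    hence "padic_rat (of_nat m - of_nat n) = (0 :: 'a padic)"
      by (simp add: of_nat_eq_padic_rat padic_rat_diff)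
    hence "padic_rat_abs CARD('a) (of_nat m - of_nat n) = 0"
      by (metis padic_abs_0 padic_abs_padic_rat)
    thus "m = n" by (simp add: padic_rat_abs_eq_0_iff[OF prime_card])
  qed
qed

lemma padic_abs_prime:
  "padic_abs (of_nat CARD('p) :: 'p::prime_card padic) = 1 / real CARD('p)"
proof -
  have "padic_rat_abs CARD('p) (of_int (int CARD('p)) / of_int 1)
     = real CARD('p) powi (int (multiplicity (int CARD('p)) 1) - int (multiplicity (int CARD('p)) (int CARD('p))))"
    by (rule padic_rat_abs_fraction[OF prime_card]) auto
  moreover have "multiplicity (int CARD('p)) (int CARD('p)) = 1"
    using prime_card[where 'a='p] by (intro multiplicity_self) (auto simp: prime_gt_1_nat)
  ultimately show ?thesis by (simp add: padic_abs_of_nat power_int_minus field_simps)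
qed

lemma prime_card_gt_1: "CARD('p::prime_card) > 1"
  using prime_card[where 'a='p] by (rule prime_gt_1_nat)

lemma padic_approx:
  fixes x :: "'p::prime_card padic"
  assumes "e > 0"
  obtains q where "padic_abs (x - padic_rat q) < e"
proof -
  obtain S where S: "padic_eqv CARD('p) S S" "x = padic_of_seq S"
    using Quotient_padic[where 'p='p] unfolding Quotient_def by metis
  hence "padic_Cauchy CARD('p) S" by (simp add: padic_eqv_def)
  then obtain N where N: "\<And>m n. m \<ge> N \<Longrightarrow> n \<ge> N \<Longrightarrow> padic_rat_abs CARD('p) (S m - S n) < e / 2"
    using padic_CauchyD[OF prime_card, of S "e / 2"] assms by (metis half_gt_zero)
  let ?T = "\<lambda>n. S n - S N"
  have T: "padic_eqv CARD('p) ?T ?T"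
    using padic_eqv_add[OF prime_card S(1) padic_eqv_const[of "- S N"]] by simp
  have "x - padic_rat (S N) = padic_of_seq (\<lambda>n. S n + - S N)"
    unfolding S(2) padic_rat_def diff_conv_add_uminus map_fun_def id_def comp_def
    by (subst uminus_padic.abs_eq[OF padic_eqv_const],
        subst plus_padic.abs_eq[OF S(1) padic_eqv_const]) (rule refl)
  hence "padic_abs (x - padic_rat (S N)) = padic_abs (padic_of_seq ?T :: 'p padic)" by simp
  also have "\<dots> \<le> e / 2"
    by (rule LIMSEQ_le_const2[OF padic_abs_tendsto[OF T]]) (use N less_imp_le in blast)
  also have "\<dots> < e" using assms by simp
  finally show ?thesis using that by blast
qed

text \<open>The value group is discrete: by the isosceles property, an element has the same absolute value as
  every rational that is close enough to it. This discreteness is indispensable: over an algebraic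
  closure, where the value group is divisible, every non-zero scalar has roots of all orders.\<close>

lemma padic_abs_value_group:
  fixes x :: "'p::prime_card padic"
  assumes "x \<noteq> 0"
  obtains z :: int where "padic_abs x = real CARD('p) powi z"
proof -
  obtain q where q: "padic_abs (x - padic_rat q) < padic_abs x"
    using padic_approx[of "padic_abs x" x] assms by auto
  hence eq: "padic_abs x = padic_rat_abs CARD('p) q"
    using padic_abs_add_eq_left[of "padic_rat q - x" x] padic_abs_minus[of "x - padic_rat q"]
    by (simp add: padic_abs_padic_rat)
  with assms have "q \<noteq> 0" by auto
  thus ?thesis using that eq by (auto simp: padic_rat_abs_def)
qed

lemma padic_abs_less_1D:
  fixes x :: "'p::prime_card padic"
  assumes "padic_abs x < 1"
  shows "padic_abs x \<le> 1 / real CARD('p)"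
proof (cases "x = 0")
  case False
  then obtain z where z: "padic_abs x = real CARD('p) powi z" by (rule padic_abs_value_group)
  have p: "real CARD('p) > 1" using prime_card_gt_1[where 'p='p] by simp
  have "z < 0"
  proof (rule ccontr)
    assume "\<not> z < 0"
    hence "real CARD('p) powi z \<ge> 1" using p by (intro one_le_power_int) auto
    thus False using assms z by simp
  qed
  hence "real CARD('p) powi z \<le> real CARD('p) powi (-1)"
    using p by (intro power_int_increasing) auto
  thus ?thesis using z by (simp add: power_int_minus field_simps)
qed (simp add: padic_abs_0)

lemma padic_abs_gt_1D:
  fixes x :: "'p::prime_card padic"
  assumes "padic_abs x > 1"
  shows "padic_abs x \<ge> real CARD('p)"
proof -
  have "inverse (padic_abs x) \<le> 1 / real CARD('p)"
    using padic_abs_less_1D[of "inverse x"] assms by (simp add: padic_abs_inverse inverse_less_1_iff)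
  moreover have "padic_abs x > 0" using assms by linarith
  ultimately show ?thesis
    using prime_card_gt_1[where 'p='p] by (simp only: inverse_eq_divide) (simp add: field_simps del: padic_abs_pos_iff)
qed

text \<open>Finiteness of the residue field. A rational \<open>a / b\<close> close to \<open>x\<close> has a denominator prime to \<open>p\<close>, so
  \<open>b\<close> can be inverted modulo \<open>p\<close> and \<open>a / b\<close> replaced by a natural number.\<close>

lemma padic_residue:
  fixes x :: "'p::prime_card padic"
  assumes "padic_abs x \<le> 1"
  obtains c where "c < CARD('p)" "padic_abs (x - of_nat c) < 1"
proof -
  let ?p = "CARD('p)"
  have prp: "Factorial_Ring.prime ?p" by (rule prime_card)
  obtain q where q: "padic_abs (x - padic_rat q) < 1"
    using padic_approx[of 1 x] by auto
  have "padic_abs (padic_rat q :: 'p padic) \<le> 1"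
    using padic_abs_diff_ultra[of x "x - padic_rat q"] q assms by simp
  hence q1: "padic_rat_abs ?p q \<le> 1" by (simp add: padic_abs_padic_rat)
  obtain a b where ab: "quotient_of q = (a, b)" by (cases "quotient_of q")
  have b: "b > 0" and cop: "coprime a b" and qab: "q = of_int a / of_int b"
    using quotient_of_denom_pos[OF ab] quotient_of_coprime[OF ab] quotient_of_div[OF ab] by auto
  have nb: "\<not> int ?p dvd b"
  proof
    assume pb: "int ?p dvd b"
    have pa: "\<not> int ?p dvd a"
      using cop pb prp not_coprimeI[of "int ?p" a b] by (metis not_prime_unit prime_nat_int_transfer)
    hence "a \<noteq> 0" by auto
    have "padic_rat_abs ?p q = real ?p powi (int (multiplicity (int ?p) b) - int (multiplicity (int ?p) a))"
      unfolding qab using \<open>a \<noteq> 0\<close> b by (intro padic_rat_abs_fraction prp) auto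
    moreover have "multiplicity (int ?p) a = 0" using pa by (rule not_dvd_imp_multiplicity_0)
    moreover have "multiplicity (int ?p) b > 0"
      using pb b prp by (subst prime_multiplicity_gt_zero_iff) auto
    moreover from this have "real ?p ^ multiplicity (int ?p) b > 1"
      using prime_card_gt_1[where 'p='p] by (intro one_less_power) auto
    ultimately show False using q1 by simp
  qed
  hence "coprime b (int ?p)"
    using prp by (metis coprime_commute prime_imp_coprime prime_nat_int_transfer)
  then obtain b' where b': "[b * b' = 1] (mod int ?p)"
    using cong_solve_coprime_int by blast
  define c where "c = nat ((a * b') mod int ?p)"
  have c: "c < ?p" "int c = (a * b') mod int ?p"
    using prime_card_gt_1[where 'p='p] by (auto simp: c_def nat_less_iff)
  have "[b * int c = b * (a * b')] (mod int ?p)" unfolding c(2) by (simp add: cong_def mod_mult_right_eq)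
  also have "b * (a * b') = a * (b * b')" by simp
  also have "[a * (b * b') = a * 1] (mod int ?p)" by (intro cong_mult b' cong_refl)
  finally have "int ?p dvd a - b * int c" by (simp add: cong_iff_dvd_diff dvd_diff_commute)
  hence small: "padic_rat_abs ?p (q - of_nat c) < 1"
  proof (cases "a - b * int c = 0")
    case True
    hence "a = b * int c" by simp
    hence "q = of_nat c" using b by (simp add: qab)
    thus ?thesis by simp
  next
    case False
    have "q - of_nat c = of_int (a - b * int c) / of_int b"
      using b by (simp add: qab diff_divide_distrib)
    hence "padic_rat_abs ?p (q - of_nat c)
      = real ?p powi (int (multiplicity (int ?p) b) - int (multiplicity (int ?p) (a - b * int c)))"
      using False b by (simp only:) (intro padic_rat_abs_fraction prp, auto)
    moreover have "multiplicity (int ?p) b = 0" using nb by (rule not_dvd_imp_multiplicity_0)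
    moreover have "multiplicity (int ?p) (a - b * int c) > 0"
      using \<open>int ?p dvd a - b * int c\<close> False prp by (subst prime_multiplicity_gt_zero_iff) auto
    moreover from this have "real ?p ^ multiplicity (int ?p) (a - b * int c) > 1"
      using prime_card_gt_1[where 'p='p] by (intro one_less_power) auto
    ultimately show ?thesis by (simp add: power_int_minus inverse_less_1_iff)
  qed
  have "padic_abs (x - of_nat c) = padic_abs ((x - padic_rat q) + padic_rat (q - of_nat c))"
    by (simp add: padic_rat_diff of_nat_eq_padic_rat)
  also have "\<dots> < 1"
    using q small by (intro padic_abs_add_less) (auto simp: padic_abs_padic_rat)
  finally show ?thesis using that c by blast
qed

text \<open>Addition and multiplication are continuous, so that polynomial functions on the field are
  continuous by the library rules for topological monoids.\<close>

instance padic :: (prime_card) topological_monoid_add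
proof
  fix a b :: "'a padic"
  show "LIM x (nhds a \<times>\<^sub>F nhds b). fst x + snd x :> nhds (a + b)"
  proof (rule tendstoI)
    fix e :: real assume "e > 0"
    hence "\<forall>\<^sub>F x in nhds a \<times>\<^sub>F nhds b. dist (fst x) a < e \<and> dist (snd x) b < e"
      by (intro eventually_conj tendstoD[OF filterlim_fst] tendstoD[OF filterlim_snd])
    thus "\<forall>\<^sub>F x in nhds a \<times>\<^sub>F nhds b. dist (fst x + snd x) (a + b) < e"
    proof eventually_elim
      case (elim x)
      have eq: "fst x + snd x - (a + b) = (fst x - a) + (snd x - b)" by simp
      show ?case unfolding dist_padic_def eq
        using elim by (intro padic_abs_add_less) (auto simp: dist_padic_def)
    qed
  qed
qed

instance padic :: (prime_card) topological_semigroup_mult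
proof
  fix a b :: "'a padic"
  show "LIM x (nhds a \<times>\<^sub>F nhds b). fst x * snd x :> nhds (a * b)"
  proof (rule tendstoI)
    fix e :: real assume e: "e > 0"
    define M where "M = max 1 (max (padic_abs a) (padic_abs b))"
    define d where "d = min 1 (e / M)"
    have M: "M \<ge> 1" "padic_abs a \<le> M" "padic_abs b \<le> M" by (auto simp: M_def)
    have d: "d > 0" "d \<le> 1" "d * M \<le> e" using e M(1) by (auto simp: d_def min_def field_simps)
    have "\<forall>\<^sub>F x in nhds a \<times>\<^sub>F nhds b. dist (fst x) a < d \<and> dist (snd x) b < d"
      using d(1) by (intro eventually_conj tendstoD[OF filterlim_fst] tendstoD[OF filterlim_snd])
    thus "\<forall>\<^sub>F x in nhds a \<times>\<^sub>F nhds b. dist (fst x * snd x) (a * b) < e"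
    proof eventually_elim
      case (elim x)
      hence 1: "padic_abs (fst x - a) < d" "padic_abs (snd x - b) < d" by (auto simp: dist_padic_def)
      have 2: "padic_abs (snd x) \<le> M"
        using padic_abs_add_le[of "snd x - b" M b] 1 d M by simp
      have "fst x * snd x - a * b = (fst x - a) * snd x + a * (snd x - b)" by (simp add: algebra_simps)
      moreover have "padic_abs ((fst x - a) * snd x) < e"
      proof -
        have "padic_abs (fst x - a) * padic_abs (snd x) \<le> padic_abs (fst x - a) * M"
          using 2 by (intro mult_left_mono) auto
        also have "\<dots> < d * M" using 1 M(1) by (intro mult_strict_right_mono) auto
        finally show ?thesis using d(3) by (simp add: padic_abs_mult)
      qed
      moreover have "padic_abs (a * (snd x - b)) < e"
      proof -
        have "padic_abs (snd x - b) * padic_abs a \<le> padic_abs (snd x - b) * M"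
          using M by (intro mult_left_mono) auto
        also have "\<dots> < d * M" using 1 M(1) by (intro mult_strict_right_mono) auto
        finally show ?thesis using d(3) by (simp add: padic_abs_mult mult.commute)
      qed
      ultimately show ?case by (simp add: dist_padic_def padic_abs_add_less)
    qed
  qed
qed

section \<open>Polynomials over the valuation ring\<close>

text \<open>The polynomials over \<open>\<int>\<^sub>p\<close>, kept inside the polynomials over \<open>\<rat>\<^sub>p\<close> so that division with remainder
  is available from the library.\<close>

definition integral_poly :: "'p::prime_card padic poly \<Rightarrow> bool" where
  "integral_poly u \<longleftrightarrow> (\<forall>i. padic_abs (coeff u i) \<le> 1)"

lemma integral_poly_0 [simp]: "integral_poly 0"
  by (simp add: integral_poly_def padic_abs_0)

lemma integral_poly_monom: "padic_abs c \<le> 1 \<Longrightarrow> integral_poly (monom c n)"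
  by (simp add: integral_poly_def padic_abs_0)

lemma integral_poly_1 [simp]: "integral_poly 1"
  using integral_poly_monom[of 1 0] by (simp add: monom_0 one_pCons)

lemma integral_poly_add: "integral_poly u \<Longrightarrow> integral_poly v \<Longrightarrow> integral_poly (u + v)"
  by (simp add: integral_poly_def padic_abs_add_le)

lemma integral_poly_diff: "integral_poly u \<Longrightarrow> integral_poly v \<Longrightarrow> integral_poly (u - v)"
  unfolding integral_poly_def coeff_diff
  by (meson max.boundedI order.trans padic_abs_diff_ultra)

lemma integral_poly_mult: "integral_poly u \<Longrightarrow> integral_poly v \<Longrightarrow> integral_poly (u * v)"
  unfolding integral_poly_def coeff_mult
  by (intro allI padic_abs_sum_le) (auto simp: padic_abs_mult mult_le_one)

lemma integral_poly_smult: "padic_abs c \<le> 1 \<Longrightarrow> integral_poly u \<Longrightarrow> integral_poly (smult c u)"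
  by (simp add: integral_poly_def padic_abs_mult mult_le_one)

lemma integral_poly_power: "integral_poly u \<Longrightarrow> integral_poly (u ^ n)"
  by (induction n) (auto intro: integral_poly_mult)

lemma integral_poly_sum: "(\<And>i. i \<in> I \<Longrightarrow> integral_poly (u i)) \<Longrightarrow> integral_poly (sum u I)"
  by (induction I rule: infinite_finite_induct) (auto intro: integral_poly_add)

lemma integral_poly_of_nat: "integral_poly (of_nat n)"
  by (induction n) (auto intro: integral_poly_add)

text \<open>Long division by a monic polynomial never divides by a non-unit, so it stays within \<open>\<int>\<^sub>p[x]\<close>.\<close>

lemma integral_poly_mod:
  assumes f: "integral_poly f" "lead_coeff f = 1" and u: "integral_poly u"
  shows "integral_poly (u mod f)"
  using u
proof (induction "if u = 0 then 0 else Suc (degree u)" arbitrary: u rule: less_induct)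
  case less
  show ?case
  proof (cases "u = 0 \<or> degree u < degree f")
    case True
    thus ?thesis using less.prems by (auto simp: mod_poly_less)
  next
    case False
    define t where "t = monom (lead_coeff u) (degree u - degree f)"
    define v where "v = u - t * f"
    have f0: "f \<noteq> 0" using f(2) by auto
    have "lead_coeff u \<noteq> 0" using False by auto
    hence t0: "t \<noteq> 0" "degree t = degree u - degree f" by (auto simp: t_def degree_monom_eq)
    have deg: "degree (t * f) = degree u" using t0 f0 False by (simp add: degree_mult_eq)
    have "coeff (t * f) (degree u) = lead_coeff t * lead_coeff f"
      using deg by (metis lead_coeff_mult)
    also have "\<dots> = coeff u (degree u)" using f(2) t0 by (simp add: t_def)
    finally have cv: "coeff v (degree u) = 0" by (simp add: v_def)
    have "degree v \<le> degree u" unfolding v_def using deg by (metis degree_diff_le order.refl)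
    hence small: "(if v = 0 then 0 else Suc (degree v)) < (if u = 0 then 0 else Suc (degree u))"
      using cv False by (metis eq_zero_or_degree_less le_neq_implies_less leading_coeff_0_iff not_less_eq zero_less_Suc)
    have "integral_poly t" unfolding t_def
      using less.prems by (intro integral_poly_monom) (auto simp: integral_poly_def)
    hence "integral_poly v" unfolding v_def
      by (intro integral_poly_diff integral_poly_mult less.prems f)
    hence "integral_poly (v mod f)" using less.hyps small by blast
    moreover have "v mod f = u mod f" unfolding v_def by (simp add: mod_eq_dvd_iff)
    ultimately show ?thesis by simp
  qed
qed

section \<open>Gauss norms and integrality of factors\<close>

text \<open>The Gauss norm of radius \<open>R\<close> is the maximum of these terms over \<open>i\<close>. The indices where the maximum is
  attained matter more than its value: a tie between two indices corresponds to a root of absolute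
  value \<open>R\<close> in an algebraic closure, that is to an edge of the Newton polygon. Working with ties makes
  it possible to bound roots without extending the absolute value to an algebraic closure.\<close>

definition gauss_term :: "real \<Rightarrow> 'p::prime_card padic poly \<Rightarrow> nat \<Rightarrow> real" where
  "gauss_term R u i = padic_abs (coeff u i) * R ^ i"

lemma gauss_term_nonneg: "R > 0 \<Longrightarrow> gauss_term R u i \<ge> 0"
  by (simp add: gauss_term_def)

lemma gauss_term_mult_le:
  assumes R: "R > 0" and "M \<ge> 0" "L \<ge> 0"
    and f: "\<And>i. gauss_term R f i \<le> M" and q: "\<And>i. gauss_term R q i \<le> L"
  shows "gauss_term R (f * q) n \<le> M * L"
proof -
  have P: "R ^ n > 0" using R by simp
  have "padic_abs (coeff f i * coeff q (n - i)) \<le> M * L / R ^ n" if "i \<in> {..n}" for i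
  proof -
    have "padic_abs (coeff f i * coeff q (n - i)) * R ^ n = gauss_term R f i * gauss_term R q (n - i)"
      using that by (simp add: gauss_term_def padic_abs_mult flip: power_add)
    also have "\<dots> \<le> M * L" using f q assms by (intro mult_mono gauss_term_nonneg) auto
    finally show ?thesis using P by (simp add: field_simps)
  qed
  hence "padic_abs (coeff (f * q) n) \<le> M * L / R ^ n"
    unfolding coeff_mult using P assms by (intro padic_abs_sum_le) auto
  thus ?thesis using P by (simp add: gauss_term_def field_simps)
qed

text \<open>If one summand of the convolution that defines a coefficient of \<open>f * q\<close> is strictly larger than all the
  others, the ultrametric inequality makes it determine the absolute value of that coefficient.\<close>

lemma gauss_term_mult_dominant:
  assumes R: "R > 0"
    and dom: "\<And>i j. i + j = a + b \<Longrightarrow> i \<noteq> a \<Longrightarrow>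
               gauss_term R f i * gauss_term R q j < gauss_term R f a * gauss_term R q b"
    and pos: "gauss_term R f a * gauss_term R q b > 0"
  shows "gauss_term R (f * q) (a + b) = gauss_term R f a * gauss_term R q b"
proof -
  let ?t = "\<lambda>i. coeff f i * coeff q (a + b - i)"
  have eq: "padic_abs (?t i) * R ^ (a + b) = gauss_term R f i * gauss_term R q (a + b - i)"
    if "i \<le> a + b" for i
    using that by (simp add: gauss_term_def padic_abs_mult flip: power_add)
  have P: "R ^ (a + b) > 0" using R by simp
  have less: "padic_abs (?t i) < padic_abs (?t a)" if "i \<in> {..a + b} - {a}" for i
  proof -
    have "padic_abs (?t i) * R ^ (a + b) < padic_abs (?t a) * R ^ (a + b)"
      using that dom[of i "a + b - i"] by (simp only: eq) (simp add: eq)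
    thus ?thesis using P by simp
  qed
  have "padic_abs (?t a) * R ^ (a + b) > 0" using pos eq[of a] by simp
  hence "padic_abs (?t a) > 0" using P by (rule zero_less_mult_pos2)
  hence "padic_abs (\<Sum>i\<in>{..a + b} - {a}. ?t i) < padic_abs (?t a)"
    using less by (intro padic_abs_sum_less) auto
  hence "padic_abs (?t a + (\<Sum>i\<in>{..a + b} - {a}. ?t i)) = padic_abs (?t a)"
    by (rule padic_abs_add_eq_left)
  hence "padic_abs (coeff (f * q) (a + b)) = padic_abs (?t a)"
    by (simp add: coeff_mult sum.remove[of "{..a + b}" a])
  thus ?thesis using eq[of a] by (simp add: gauss_term_def[of R "f * q"])
qed

lemma gauss_term_extremal_indices:
  assumes R: "R > 0" and q: "q \<noteq> 0"
  obtains M a b where "M > 0" "\<And>i. gauss_term R q i \<le> M"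
    "gauss_term R q a = M" "gauss_term R q b = M"
    "\<And>i. gauss_term R q i = M \<Longrightarrow> a \<le> i \<and> i \<le> b"
proof -
  define M where "M = Max (gauss_term R q ` {..degree q})"
  have le: "gauss_term R q i \<le> M" if "i \<le> degree q" for i
    unfolding M_def using that by (intro Max_ge) auto
  have "gauss_term R q (degree q) > 0" using R q by (simp add: gauss_term_def)
  hence M: "M > 0" using le[of "degree q"] by linarith
  have zero: "gauss_term R q i = 0" if "i > degree q" for i
    using that by (simp add: gauss_term_def coeff_eq_0 padic_abs_0)
  have le': "gauss_term R q i \<le> M" for i
    using le[of i] zero[of i] M by (cases "i \<le> degree q") auto
  define T where "T = {i. gauss_term R q i = M}"
  have "M \<in> gauss_term R q ` {..degree q}" unfolding M_def by (intro Max_in) auto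
  hence "T \<noteq> {}" by (auto simp: T_def)
  moreover have "T \<subseteq> {..degree q}" using zero M by (auto simp: T_def) (metis less_irrefl not_le)
  hence "finite T" by (rule finite_subset) auto
  ultimately have "Min T \<in> T" "Max T \<in> T" "\<And>i. i \<in> T \<Longrightarrow> Min T \<le> i \<and> i \<le> Max T" by auto
  thus ?thesis using that[of M "Min T" "Max T"] M le' by (auto simp: T_def)
qed

text \<open>A factor of a polynomial whose Gauss norm is attained only once attains its own norm only once. The
  least maximal indices of \<open>f\<close> and \<open>q\<close> add up to a maximal index of \<open>f * q\<close>, and so do the greatest
  ones; if these two sums agree, both pairs of indices do.\<close>

lemma gauss_dominant_factor:
  assumes R: "R > 0" and fq: "f * q \<noteq> 0"
    and dom: "\<And>i. i \<noteq> N \<Longrightarrow> gauss_term R (f * q) i < gauss_term R (f * q) N"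
    and max: "\<And>i. gauss_term R f i \<le> gauss_term R f a"
    and tie: "gauss_term R f b = gauss_term R f a"
  shows "a = b"
proof -
  have "f \<noteq> 0" "q \<noteq> 0" using fq by auto
  obtain M a1 a2 where f: "M > 0" "\<And>i. gauss_term R f i \<le> M" "gauss_term R f a1 = M"
    "gauss_term R f a2 = M" "\<And>i. gauss_term R f i = M \<Longrightarrow> a1 \<le> i \<and> i \<le> a2"
    using gauss_term_extremal_indices[OF R \<open>f \<noteq> 0\<close>] by metis
  obtain L b1 b2 where q: "L > 0" "\<And>i. gauss_term R q i \<le> L" "gauss_term R q b1 = L"
    "gauss_term R q b2 = L" "\<And>i. gauss_term R q i = L \<Longrightarrow> b1 \<le> i \<and> i \<le> b2"
    using gauss_term_extremal_indices[OF R \<open>q \<noteq> 0\<close>] by metis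
  have prod: "gauss_term R f i * gauss_term R q j < M * L"
    if "gauss_term R f i \<noteq> M \<or> gauss_term R q j \<noteq> L" for i j
  proof (cases "gauss_term R f i = M")
    case False
    hence "gauss_term R f i < M" using f(2)[of i] by linarith
    hence "gauss_term R f i * L < M * L" using q(1) by simp
    moreover have "gauss_term R f i * gauss_term R q j \<le> gauss_term R f i * L"
      using q(2) by (intro mult_left_mono gauss_term_nonneg R)
    ultimately show ?thesis by linarith
  next
    case True
    hence "gauss_term R q j < L" using that q(2)[of j] by linarith
    thus ?thesis using True f(1) by simp
  qed
  have lo: "gauss_term R (f * q) (a1 + b1) = M * L"
    using f(1,3) q(1,3) prod
    by (subst gauss_term_mult_dominant[OF R])
       (auto, metis add_le_cancel_right add_left_cancel antisym_conv f(5) nat_add_left_cancel_le q(5))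
  have hi: "gauss_term R (f * q) (a2 + b2) = M * L"
    using f(1,4) q(1,4) prod
    by (subst gauss_term_mult_dominant[OF R])
       (auto, metis add_le_cancel_right add_left_cancel antisym_conv f(5) nat_add_left_cancel_le q(5))
  have "gauss_term R (f * q) N \<le> M * L"
    using R f(1,2) q(1,2) by (intro gauss_term_mult_le) auto
  hence "a1 + b1 = a2 + b2"
    using dom[of "a1 + b1"] dom[of "a2 + b2"] lo hi by fastforce
  hence "a1 = a2" using f(3,5) q(3,5) by (metis add_le_cancel_left add_le_imp_le_right le_antisym add_left_mono)
  moreover have "gauss_term R f a = M" using max[of a1] f(2)[of a] f(3) by linarith
  ultimately show ?thesis using f(5)[of a] f(5)[of b] tie by simp
qed

lemma coeff_pcompose_monom:
  fixes p :: "'a::comm_semiring_1 poly"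
  assumes "k > 0"
  shows "coeff (pcompose p (monom 1 k)) i = (if k dvd i then coeff p (i div k) else 0)"
proof (induction p arbitrary: i)
  case (pCons a p)
  show ?case
  proof (cases "i < k")
    case True
    thus ?thesis using assms by (cases i)
      (auto simp: pcompose_pCons coeff_monom_mult coeff_pCons dvd_imp_le split: nat.splits dest: dvd_imp_le)
  next
    case False
    hence "i > 0" "k dvd i - k \<longleftrightarrow> k dvd i" "i div k = Suc ((i - k) div k)"
      using assms by (auto simp: dvd_minus_self le_div_geq)
    thus ?thesis using False
      by (cases i) (auto simp: pcompose_pCons coeff_monom_mult pCons.IH coeff_pCons)
  qed
qed auto

text \<open>A bound on the roots of \<open>f\<close>: their \<open>k\<close>-th powers are roots of \<open>G\<close>, and the roots of \<open>G\<close> are bounded by \<open>B\<close>,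
  hence the roots of \<open>f\<close> are bounded by \<open>B\<close> to the power \<open>1 / k\<close>. A monic polynomial of degree at most \<open>D\<close>
  that is not integral has a root of absolute value at least \<open>p\<close> to the power \<open>1 / D\<close>, by discreteness of
  the value group. For large \<open>k\<close> the two are incompatible. In the proof a root of maximal absolute value
  is replaced by a radius \<open>R\<close> at which \<open>f\<close> has a tie.\<close>

lemma integral_poly_of_dvd_pcompose_monom:
  fixes f G :: "'p::prime_card padic poly"
  assumes f: "lead_coeff f = 1" "degree f \<le> D" and G: "lead_coeff G = 1"
    and B: "\<And>i. padic_abs (coeff G i) \<le> B"
    and k: "k \<ge> D * m" "k > 0" "real CARD('p) ^ m > B"
    and dvd: "f dvd pcompose G (monom 1 k)"
  shows "integral_poly f"
proof (rule ccontr)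
  let ?p = "real CARD('p)"
  have p1: "?p > 1" using prime_card_gt_1[where 'p='p] by simp
  assume "\<not> integral_poly f"
  then obtain l where l: "padic_abs (coeff f l) > 1" by (auto simp: integral_poly_def not_le)
  define d where "d = degree f"
  have "l \<le> d" unfolding d_def using l by (intro le_degree) (auto simp: padic_abs_0)
  moreover have "l \<noteq> d" using l f by (auto simp: d_def)
  ultimately have ld: "l < d" by simp
  \<comment> \<open>The radius at which the terms of index \<open>i\<close> and \<open>d\<close> are equal. The largest of these radii is the
    largest absolute value of a root, and there the leading term is maximal, but not alone.\<close>
  define r where "r = (\<lambda>i. root (d - i) (padic_abs (coeff f i)))"
  define R where "R = Max (r ` {..<d})"
  have r_pow: "r i ^ (d - i) = padic_abs (coeff f i)" if "i < d" for i
    using that by (simp add: r_def)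
  have r_nonneg: "r i \<ge> 0" for i by (simp add: r_def real_root_ge_zero)
  have rR: "r i \<le> R" if "i < d" for i unfolding R_def using that by (intro Max_ge) auto
  have "R \<in> r ` {..<d}" unfolding R_def using ld by (intro Max_in) auto
  then obtain b where b: "b < d" "r b = R" by auto
  have "r l > 1" using l ld by (simp add: r_def)
  hence R1: "R > 1" using rR[OF ld] by linarith
  have le: "padic_abs (coeff f i) \<le> R ^ (d - i)" if "i < d" for i
    using r_pow[OF that] rR[OF that] r_nonneg by (metis power_mono)
  have "?p \<le> padic_abs (coeff f l)" using l by (rule padic_abs_gt_1D)
  also have "\<dots> \<le> R ^ (d - l)" using le ld by simp
  also have "\<dots> \<le> R ^ D" using R1 f by (intro power_increasing) (auto simp: d_def)
  finally have "?p ^ m \<le> (R ^ D) ^ m" using p1 by (intro power_mono) auto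
  also have "\<dots> = R ^ (D * m)" by (simp add: power_mult)
  also have "\<dots> \<le> R ^ k" using R1 k by (intro power_increasing) auto
  finally have RB: "R ^ k > B" using k by linarith
  have top: "gauss_term R f d = R ^ d" using f by (simp add: gauss_term_def d_def)
  have split: "R ^ (d - i) * R ^ i = R ^ d" if "i < d" for i
    using that by (simp flip: power_add)
  have max: "gauss_term R f i \<le> gauss_term R f d" for i
  proof (cases i d rule: linorder_cases)
    case less
    hence "gauss_term R f i \<le> R ^ (d - i) * R ^ i"
      unfolding gauss_term_def using le R1 by (intro mult_right_mono) auto
    thus ?thesis using less top split by simp
  next
    case greater
    thus ?thesis using R1 top by (simp add: gauss_term_def d_def coeff_eq_0 padic_abs_0)
  qed simp
  have tie: "gauss_term R f b = gauss_term R f d"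
    unfolding gauss_term_def[of R f b] r_pow[OF b(1), symmetric] b(2) top by (rule split[OF b(1)])
  obtain q where q: "pcompose G (monom 1 k) = f * q" using dvd by (auto elim: dvdE)
  define e where "e = degree G"
  have coeffF: "coeff (f * q) i = (if k dvd i then coeff G (i div k) else 0)" for i
    unfolding q[symmetric] by (rule coeff_pcompose_monom[OF k(2)])
  have topF: "gauss_term R (f * q) (k * e) = R ^ (k * e)"
    using G k(2) by (simp add: gauss_term_def coeffF e_def)
  \<comment> \<open>At this radius the leading term of \<open>G(x ^ k)\<close> dominates strictly, because \<open>R ^ k\<close> exceeds every
    coefficient of \<open>G\<close>.\<close>
  have dom: "gauss_term R (f * q) i < gauss_term R (f * q) (k * e)" if "i \<noteq> k * e" for i
  proof (cases "k dvd i \<and> i div k < e")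
    case True
    then obtain j where j: "i = k * j" "j < e" using k(2) by auto
    have "gauss_term R (f * q) i \<le> B * R ^ (k * j)"
      unfolding gauss_term_def j coeffF using B R1 k(2) by (simp add: mult_right_mono)
    also have "\<dots> < R ^ k * R ^ (k * j)" using RB R1 by simp
    also have "\<dots> = R ^ (k * Suc j)" by (simp add: power_add)
    also have "\<dots> \<le> R ^ (k * e)" using R1 j by (intro power_increasing mult_le_mono) auto
    finally show ?thesis using topF by simp
  next
    case False
    have "coeff (f * q) i = 0"
    proof (cases "k dvd i")
      case True
      with False that have "i div k > e" by auto
      thus ?thesis by (simp add: coeffF e_def coeff_eq_0)
    qed (simp add: coeffF)
    thus ?thesis using R1 topF by (simp add: gauss_term_def[of R _ i] padic_abs_0)
  qed
  have "gauss_term R (f * q) (k * e) > 0" using topF R1 by simp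
  hence "f * q \<noteq> 0" by (auto simp: gauss_term_def padic_abs_0)
  hence "d = b" using R1 dom max tie by (intro gauss_dominant_factor[of R f q "k * e" d b]) auto
  thus False using b by simp
qed

section \<open>Powers of the variable modulo an integral polynomial\<close>

lemma integral_poly_power_add:
  assumes "integral_poly v" "integral_poly z"
  obtains t where "integral_poly t" "(v + z) ^ n = v ^ n + of_nat n * z * v ^ (n - 1) + z\<^sup>2 * t"
proof -
  have "\<exists>t. integral_poly t \<and> (v + z) ^ n = v ^ n + of_nat n * z * v ^ (n - 1) + z\<^sup>2 * t"
  proof (induction n)
    case 0
    show ?case by (intro exI[of _ 0]) auto
  next
    case (Suc n)
    then obtain t where t: "integral_poly t"
      "(v + z) ^ n = v ^ n + of_nat n * z * v ^ (n - 1) + z\<^sup>2 * t" by blast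
    define t' where "t' = v * t + of_nat n * v ^ (n - 1) + z * t"
    have "integral_poly t'" unfolding t'_def
      using assms t(1) by (intro integral_poly_add integral_poly_mult integral_poly_power integral_poly_of_nat)
    moreover have "of_nat n * z * v ^ (n - 1) * v = of_nat n * z * v ^ n" by (cases n) auto
    hence "(v + z) ^ Suc n = v ^ Suc n + of_nat (Suc n) * z * v ^ (Suc n - 1) + z\<^sup>2 * t'"
      unfolding t'_def power_Suc2 t(2) by (simp add: algebra_simps power2_eq_square)
    ultimately show ?case by blast
  qed
  thus ?thesis using that by blast
qed

lemma diff_dvd_power_diff: "(x :: 'a::comm_ring_1) - y dvd x ^ n - y ^ n"
  by (cases n) (auto simp: diff_power_eq_sum simp del: power_Suc)

text \<open>Congruence modulo the ideal generated by \<open>p ^ s\<close> and \<open>f\<close>. The cofactor \<open>q\<close> of \<open>f\<close> is left arbitrary, as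
  the congruences will only be evaluated at a matrix annihilated by \<open>f\<close>.\<close>

definition congruent_mod ::
  "'p::prime_card padic poly \<Rightarrow> nat \<Rightarrow> 'p padic poly \<Rightarrow> 'p padic poly \<Rightarrow> bool" where
  "congruent_mod f s u v \<longleftrightarrow>
     (\<exists>w q. integral_poly w \<and> u = v + smult (of_nat CARD('p) ^ s) w + f * q)"

lemma congruent_mod_mult_left:
  assumes "congruent_mod f s u v" "integral_poly c"
  shows "congruent_mod f s (c * u) (c * v)"
proof -
  obtain w q where w: "integral_poly w" "u = v + smult (of_nat CARD('a) ^ s) w + f * q"
    using assms(1) unfolding congruent_mod_def by blast
  have "c * u = c * v + smult (of_nat CARD('a) ^ s) (c * w) + f * (c * q)"
    unfolding w(2) by (simp add: algebra_simps)
  thus ?thesis unfolding congruent_mod_def using integral_poly_mult[OF assms(2) w(1)] by blast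
qed

text \<open>Taking \<open>p\<close>-th powers improves a congruence by one power of \<open>p\<close>: in the expansion of the \<open>p\<close>-th power of
  \<open>v + p ^ (s + 1) * w\<close>, the linear term gains the factor \<open>p\<close> and the other terms are divisible by
  \<open>p ^ (2 * s + 2)\<close>.\<close>

lemma congruent_mod_power_prime:
  fixes u v f :: "'p::prime_card padic poly"
  assumes "congruent_mod f (Suc s) u v" "integral_poly v"
  shows "congruent_mod f (Suc (Suc s)) (u ^ CARD('p)) (v ^ CARD('p))"
proof -
  let ?p = "CARD('p)"
  let ?\<pi> = "of_nat ?p :: 'p padic"
  have \<pi>: "padic_abs (?\<pi> ^ n) \<le> 1" for n
    by (metis padic_abs_of_nat_le_1 of_nat_power)
  obtain w q where w: "integral_poly w" "u = v + smult (?\<pi> ^ Suc s) w + f * q"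
    using assms(1) unfolding congruent_mod_def by blast
  define z where "z = smult (?\<pi> ^ Suc s) w"
  have z: "integral_poly z" unfolding z_def by (intro integral_poly_smult w \<pi>)
  obtain t where t: "integral_poly t" "(v + z) ^ ?p = v ^ ?p + of_nat ?p * z * v ^ (?p - 1) + z\<^sup>2 * t"
    using integral_poly_power_add[OF assms(2) z] by blast
  have "u - (v + z) dvd u ^ ?p - (v + z) ^ ?p" by (rule diff_dvd_power_diff)
  hence "f dvd u ^ ?p - (v + z) ^ ?p" using w(2) unfolding z_def by (metis add_diff_cancel_left' dvd_mult_left)
  then obtain q' where q': "u ^ ?p - (v + z) ^ ?p = f * q'" by (elim dvdE)
  have e1: "of_nat ?p * z * v ^ (?p - 1) = smult (?\<pi> ^ Suc (Suc s)) (w * v ^ (?p - 1))"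
    unfolding z_def of_nat_poly by (simp add: mult_ac)
  have e2: "z\<^sup>2 * t = smult (?\<pi> ^ Suc (Suc s)) (smult (?\<pi> ^ s) (w * w * t))"
    unfolding z_def by (simp add: power2_eq_square mult_ac flip: power_add)
  have "u ^ ?p = v ^ ?p + smult (?\<pi> ^ Suc (Suc s)) (w * v ^ (?p - 1) + smult (?\<pi> ^ s) (w * w * t)) + f * q'"
    using q' unfolding t(2) e1 e2 by (simp add: algebra_simps smult_add_right)
  moreover have "integral_poly (w * v ^ (?p - 1) + smult (?\<pi> ^ s) (w * w * t))"
    by (intro integral_poly_add integral_poly_mult integral_poly_smult integral_poly_power w t \<pi> assms)
  ultimately show ?thesis unfolding congruent_mod_def by blast
qed

lemma congruent_mod_power_prime_power:
  fixes u v f :: "'p::prime_card padic poly"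
  assumes "congruent_mod f 1 u v" "integral_poly v"
  shows "congruent_mod f (Suc s) (u ^ (CARD('p) ^ s)) (v ^ (CARD('p) ^ s))"
proof (induction s)
  case 0
  show ?case using assms by simp
next
  case (Suc s)
  show ?case
    using congruent_mod_power_prime[OF Suc integral_poly_power[OF assms(2)]]
    by (simp add: mult.commute flip: power_mult)
qed

text \<open>The quotient of \<open>\<int>\<^sub>p[x]\<close> by \<open>p\<close> and \<open>f\<close> has at most \<open>p ^ D\<close> elements, so two of the first \<open>p ^ D + 1\<close> powers
  of the variable coincide in it.\<close>

lemma monom_powers_congruent_mod:
  fixes f :: "'p::prime_card padic poly"
  assumes f: "integral_poly f" "lead_coeff f = 1" "degree f \<le> D"
  obtains i j where "i < j" "j \<le> CARD('p) ^ D" "congruent_mod f 1 (monom 1 j) (monom 1 i)"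
proof -
  let ?p = "CARD('p)"
  define d where "d = degree f"
  define r where "r = (\<lambda>i. monom 1 i mod f)"
  have r_int: "integral_poly (r i)" for i
    unfolding r_def by (intro integral_poly_mod f integral_poly_monom) simp
  define res where "res = (\<lambda>x :: 'p padic. SOME c. c < ?p \<and> padic_abs (x - of_nat c) < 1)"
  have res: "res x < ?p" "padic_abs (x - of_nat (res x)) < 1" if "padic_abs x \<le> 1" for x
  proof -
    have "\<exists>c. c < ?p \<and> padic_abs (x - of_nat c) < 1" using padic_residue[OF that] by blast
    from someI_ex[OF this] show "res x < ?p" "padic_abs (x - of_nat (res x)) < 1"
      by (auto simp: res_def)
  qed
  \<comment> \<open>The residue class of \<open>x ^ i\<close>, encoded by the residues of the coefficients of its remainder.\<close>
  define F where "F = (\<lambda>i. \<lambda>l\<in>{..<d}. res (coeff (r i) l))"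
  have sub: "F ` {..?p ^ D} \<subseteq> ({..<d} \<rightarrow>\<^sub>E {..<?p})"
    unfolding F_def using res(1) r_int by (intro image_subsetI PiE_I) (auto simp: integral_poly_def)
  have "card (F ` {..?p ^ D}) \<le> card ({..<d} \<rightarrow>\<^sub>E {..<?p})"
    by (intro card_mono sub finite_PiE) auto
  also have "\<dots> = ?p ^ d" by (simp add: card_funcsetE)
  also have "\<dots> \<le> ?p ^ D"
    using f prime_card_gt_1[where 'p='p] by (intro power_increasing) (auto simp: d_def)
  also have "\<dots> < card {..?p ^ D}" by simp
  finally have "\<not> inj_on F {..?p ^ D}" by (rule pigeonhole)
  then obtain i j where ij: "i < j" "j \<le> ?p ^ D" "F i = F j"
    unfolding inj_on_def by (metis atMost_iff linorder_neqE_nat)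
  define w where "w = smult (inverse (of_nat ?p)) (r j - r i)"
  have p0: "(of_nat ?p :: 'p padic) \<noteq> 0" using prime_card_gt_1[where 'p='p] by simp
  have "f \<noteq> 0" using f(2) by auto
  have "padic_abs (coeff w l) \<le> 1" for l
  proof (cases "l < d")
    case True
    define c where "c = res (coeff (r i) l)"
    have "F i l = F j l" using ij by simp
    hence c': "c = res (coeff (r j) l)" using True by (simp add: F_def c_def)
    have "padic_abs (coeff (r i) l - of_nat c) < 1" "padic_abs (coeff (r j) l - of_nat c) < 1"
      using res(2) r_int by (simp add: c_def integral_poly_def, simp add: c' integral_poly_def)
    hence "padic_abs ((coeff (r j) l - of_nat c) - (coeff (r i) l - of_nat c)) < 1"
      using padic_abs_diff_ultra by (meson le_less_trans max_less_iff_conj)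
    hence "padic_abs (coeff (r j) l - coeff (r i) l) \<le> 1 / real ?p"
      by (intro padic_abs_less_1D) simp
    thus ?thesis using prime_card_gt_1[where 'p='p]
      by (simp add: w_def padic_abs_mult padic_abs_divide padic_abs_prime field_simps)
  next
    case False
    have "coeff (r n) l = 0" for n
    proof (cases "r n = 0")
      case rn: False
      hence "degree (r n) < d" unfolding r_def d_def using \<open>f \<noteq> 0\<close> degree_mod_less by blast
      thus ?thesis using False by (intro coeff_eq_0) simp
    qed simp
    thus ?thesis by (simp add: w_def padic_abs_0)
  qed
  hence "integral_poly w" by (simp add: integral_poly_def)
  moreover have "monom 1 j = monom 1 i + smult (of_nat ?p ^ 1) w + f * (monom 1 j div f - monom 1 i div f)"
  proof -
    have e: "smult (of_nat ?p ^ 1) w = r j - r i" using p0 by (simp add: w_def)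
    have m: "f * (monom 1 n div f) + r n = monom 1 n" for n :: nat
      unfolding r_def by simp
    have "f * (monom 1 j div f) + r j
        = (f * (monom 1 i div f) + r i) + (r j - r i) + f * (monom 1 j div f - monom 1 i div f)"
      by (simp add: algebra_simps)
    thus ?thesis by (simp only: e m)
  qed
  ultimately have "congruent_mod f 1 (monom 1 j) (monom 1 i)"
    unfolding congruent_mod_def by blast
  thus ?thesis using that ij by blast
qed

text \<open>The power \<open>x ^ k\<close> is idempotent modulo \<open>p ^ (s + 1)\<close> and \<open>f\<close>. By the pigeonhole principle
  \<open>x ^ i * x ^ m \<equiv> x ^ i\<close> modulo \<open>p\<close> for some \<open>i\<close> and \<open>m > 0\<close>, and raising this to the power \<open>p ^ s\<close> lifts it
  to the modulus \<open>p ^ (s + 1)\<close>. The factorial makes \<open>k\<close> a multiple of \<open>m * p ^ s\<close> that is at least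
  \<open>i * p ^ s\<close> whatever \<open>i\<close> and \<open>m\<close> are, so that \<open>k\<close> depends on \<open>f\<close> only through the bound \<open>D\<close> on its
  degree. Idempotence is asked for, and not \<open>x ^ k \<equiv> 1\<close>, because \<open>x\<close> is not known to be a unit modulo \<open>f\<close>.\<close>

lemma monom_power_idempotent_mod:
  fixes f :: "'p::prime_card padic poly"
  assumes f: "integral_poly f" "lead_coeff f = 1" "degree f \<le> D"
    and k: "k = fact (CARD('p) ^ D) * M * CARD('p) ^ s" "M > 0"
  shows "congruent_mod f (Suc s) (monom 1 (2 * k)) (monom 1 k)"
proof -
  let ?p = "CARD('p)" and ?P = "CARD('p) ^ s"
  obtain i j where ij: "i < j" "j \<le> ?p ^ D" and cong: "congruent_mod f 1 (monom 1 j) (monom 1 i)"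
    using monom_powers_congruent_mod[OF f] by blast
  have "congruent_mod f (Suc s) (monom 1 j ^ ?P) (monom 1 i ^ ?P)"
    by (intro congruent_mod_power_prime_power cong integral_poly_monom) simp
  hence c1: "congruent_mod f (Suc s) (monom 1 (j * ?P)) (monom 1 (i * ?P))"
    by (simp add: monom_power)
  define m where "m = j - i"
  have "m dvd fact (?p ^ D)" using ij by (intro dvd_fact) (auto simp: m_def)
  hence "m * ?P dvd k" unfolding k by (metis dvd_mult2 mult_dvd_mono dvd_refl)
  then obtain c where c: "k = m * ?P * c" by (elim dvdE)
  have "i * ?P \<le> fact (?p ^ D) * M * ?P"
  proof (rule mult_le_mono1)
    have "i \<le> ?p ^ D" using ij by simp
    also have "\<dots> \<le> fact (?p ^ D)" by (rule fact_ge_self)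
    also have "\<dots> \<le> fact (?p ^ D) * M" using k(2) by simp
    finally show "i \<le> fact (?p ^ D) * M" .
  qed
  hence ik: "i * ?P \<le> k" by (simp add: k)
  define h where "h = (\<Sum>l<c. monom (1 :: 'p padic) (m * ?P) ^ l) * monom 1 (k - i * ?P)"
  have h: "integral_poly h" unfolding h_def
    by (intro integral_poly_mult integral_poly_sum integral_poly_power integral_poly_monom) auto
  define S where "S = (\<Sum>l<c. monom (1 :: 'p padic) (m * ?P) ^ l)"
  have "monom 1 k - 1 = (monom (1 :: 'p padic) (m * ?P) - 1) * S"
    unfolding S_def by (subst power_diff_1_eq[symmetric]) (simp add: monom_power c)
  moreover have e: "monom 1 (i * ?P) * (monom (1 :: 'p padic) (m * ?P) - 1) = monom 1 (j * ?P) - monom 1 (i * ?P)"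
    using ij by (simp add: m_def right_diff_distrib mult_monom flip: add_mult_distrib)
  moreover have "monom 1 k = monom (1 :: 'p padic) (i * ?P) * monom 1 (k - i * ?P)"
    using ik by (simp add: mult_monom)
  ultimately have "monom (1 :: 'p padic) k * (monom 1 k - 1)
      = (monom 1 (i * ?P) * monom 1 (k - i * ?P)) * ((monom 1 (m * ?P) - 1) * S)"
    by simp
  also have "\<dots> = (S * monom 1 (k - i * ?P)) * (monom 1 (i * ?P) * (monom 1 (m * ?P) - 1))"
    by (simp only: mult_ac)
  finally have "monom (1 :: 'p padic) k * (monom 1 k - 1) = h * (monom 1 (j * ?P) - monom 1 (i * ?P))"
    unfolding e by (simp add: h_def S_def)
  hence eq: "monom (1 :: 'p padic) (2 * k) = monom 1 k + (h * monom 1 (j * ?P) - h * monom 1 (i * ?P))"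
    unfolding mult_2 by (simp add: algebra_simps mult_monom)
  obtain w q where "integral_poly w"
      "h * monom 1 (j * ?P) = h * monom 1 (i * ?P) + smult (of_nat ?p ^ Suc s) w + f * q"
    using congruent_mod_mult_left[OF c1 h] unfolding congruent_mod_def by blast
  thus ?thesis unfolding congruent_mod_def eq by (intro exI[of _ w] exI[of _ q]) simp
qed

section \<open>Evaluation of polynomials at a matrix\<close>

text \<open>Matrix arithmetic is carried out in the commutative ring of polynomials and transported along this ring
  homomorphism, because the type of matrices carries the entrywise product as its ring structure. In
  particular \<open>mat_poly A (monom 1 k)\<close> is the \<open>k\<close>-th power of \<open>A\<close>.\<close>

definition mat_poly :: "'a::comm_ring_1 ^ 'n ^ 'n \<Rightarrow> 'a poly \<Rightarrow> 'a ^ 'n ^ 'n" where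
  "mat_poly A p = fold_coeffs (\<lambda>a M. mat a + A ** M) p 0"

lemma mat_0 [simp]: "mat 0 = 0"
  by (simp add: vec_eq_iff mat_def)

lemma mat_add: "mat (a + b) = mat a + (mat b :: 'a::comm_ring_1 ^ 'n ^ 'n)"
  by (simp add: vec_eq_iff mat_def)

lemma mat_mult_nth: "(mat a ** B) $ i $ j = a * B $ i $ (j :: 'n::finite)"
  for B :: "'a::comm_ring_1 ^ 'n ^ 'n"
  by (simp add: mat_def matrix_matrix_mult_def if_distrib[of "\<lambda>x. x * _"] cong: if_cong)

lemma mult_mat_nth: "(B ** mat a) $ i $ j = a * B $ i $ (j :: 'n::finite)"
  for B :: "'a::comm_ring_1 ^ 'n ^ 'n"
  by (simp add: mat_def matrix_matrix_mult_def if_distrib[of "\<lambda>x. _ * x"] mult.commute cong: if_cong)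

lemma mat_mult_commute: "mat a ** B = B ** mat a" for B :: "'a::comm_ring_1 ^ 'n::finite ^ 'n"
  by (simp add: vec_eq_iff mat_mult_nth mult_mat_nth)

lemma mat_mult_mat: "mat (a * b) = mat a ** (mat b :: 'a::comm_ring_1 ^ 'n::finite ^ 'n)"
  by (simp add: vec_eq_iff mat_mult_nth) (simp add: mat_def)

lemma mat_poly_0 [simp]: "mat_poly A 0 = 0"
  by (simp add: mat_poly_def)

lemma mat_poly_pCons [simp]: "mat_poly A (pCons a p) = mat a + A ** mat_poly A p"
  by (cases "a = 0 \<and> p = 0") (auto simp: mat_poly_def)

lemma mat_poly_1 [simp]: "mat_poly A 1 = mat 1"
  by (simp add: one_pCons)

lemma mat_poly_add: "mat_poly A (p + q) = mat_poly A p + mat_poly A q"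
  by (induction p q rule: poly_induct2) (auto simp: mat_add matrix_add_ldistrib)

lemma mat_poly_smult: "mat_poly A (smult a p) = mat a ** mat_poly A p"
proof (induction p)
  case (pCons b p)
  have "A ** (mat a ** mat_poly A p) = mat a ** (A ** mat_poly A p)"
    by (metis mat_mult_commute matrix_mul_assoc)
  thus ?case using pCons by (simp add: matrix_add_ldistrib mat_mult_mat)
qed simp

lemma mat_poly_minus: "mat_poly A (- p) = - mat_poly A p"
  using mat_poly_add[of A p "- p"] by (simp add: eq_neg_iff_add_eq_0 add.commute)

lemma mat_poly_diff: "mat_poly A (p - q) = mat_poly A p - mat_poly A q"
  using mat_poly_add[of A p "- q"] by (simp add: mat_poly_minus)

lemma matrix_add_rdistrib: "(A + B) ** C = A ** C + B ** C"
  for A B :: "'a::semiring_1 ^ 'n::finite ^ 'm"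
  by (simp add: vec_eq_iff matrix_matrix_mult_def distrib_right sum.distrib)

lemma mat_poly_mult: "mat_poly A (p * q) = mat_poly A p ** mat_poly A q"
proof (induction p)
  case (pCons a p)
  have "mat_poly A (pCons a p * q) = mat a ** mat_poly A q + A ** (mat_poly A p ** mat_poly A q)"
    using pCons by (simp add: mult_pCons_left mat_poly_add mat_poly_smult)
  thus ?case by (simp add: matrix_add_rdistrib matrix_mul_assoc)
qed simp

lemma mat_poly_sum: "mat_poly A (sum p I) = (\<Sum>i\<in>I. mat_poly A (p i))"
  by (induction I rule: infinite_finite_induct) (auto simp: mat_poly_add)

lemma mat_poly_pcompose: "mat_poly A (pcompose p q) = mat_poly (mat_poly A q) p"
  by (induction p) (auto simp: pcompose_pCons mat_poly_add mat_poly_mult)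

lemma mat_poly_X [simp]: "mat_poly A (monom 1 (Suc 0)) = A"
  by (simp add: monom_Suc monom_0)

lemma mat_poly_monom_Suc:
  "mat_poly A (monom 1 (Suc k)) = mat_poly A (monom 1 k) ** A"
  using mat_poly_mult[of A "monom 1 k" "monom 1 (Suc 0)"] by (simp add: mult_monom)

lemma pcompose_monom: "pcompose (monom 1 k) p = p ^ k" for p :: "'a::comm_ring_1 poly"
  by (induction k) (auto simp: monom_Suc monom_0 pcompose_pCons)

lemma mat_poly_power: "mat_poly A (p ^ k) = mat_poly (mat_poly A p) (monom 1 k)"
  by (simp add: mat_poly_pcompose flip: pcompose_monom)

lemma nat_pow_eq_mat_poly:
  "A [^]\<^bsub>GL\<^esub> k = mat_poly A (monom 1 k)" "A [^]\<^bsub>matrix_monoid\<^esub> k = mat_poly A (monom 1 k)"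
  for A :: "'a::comm_ring_1 ^ 'n::finite ^ 'n"
proof -
  show "A [^]\<^bsub>GL\<^esub> k = mat_poly A (monom 1 k)"
    by (induction k) (auto simp: nat_pow_def GL_def monom_0 mat_poly_monom_Suc)
  show "A [^]\<^bsub>matrix_monoid\<^esub> k = mat_poly A (monom 1 k)"
    by (induction k) (auto simp: nat_pow_def matrix_monoid_def monom_0 mat_poly_monom_Suc)
qed

text \<open>The powers of \<open>A\<close> of exponent at most \<open>n\<^sup>2\<close> are too many to be linearly independent among the \<open>n \<times> n\<close>
  matrices, which are flattened to vectors to apply the dimension theory of the library.\<close>

lemma mat_poly_annihilator:
  fixes A :: "'a::field ^ 'n::finite ^ 'n"
  obtains f where "f \<noteq> 0" "degree f \<le> CARD('n) ^ 2" "mat_poly A f = 0"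
proof -
  define D where "D = CARD('n) ^ 2"
  define flat :: "'a ^ 'n ^ 'n \<Rightarrow> 'a ^ ('n \<times> 'n)" where "flat = (\<lambda>M. \<chi> ij. M $ fst ij $ snd ij)"
  define v where "v = (\<lambda>i. flat (mat_poly A (monom 1 i)))"
  have flat_eq: "flat M = flat N \<longleftrightarrow> M = N" for M N
    by (auto simp: flat_def vec_eq_iff)
  show ?thesis
  proof (cases "inj_on v {..D}")
    \<comment> \<open>A repeated power is itself a relation, and is invisible to the dependence of the set of powers.\<close>
    case False
    then obtain i j where ij: "i \<le> D" "j \<le> D" "i \<noteq> j" "v i = v j" by (auto simp: inj_on_def)
    let ?f = "monom 1 i - monom (1 :: 'a) j"
    have "coeff ?f i = 1" using ij by simp
    hence "?f \<noteq> 0" by (metis coeff_0 zero_neq_one)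
    moreover have "degree ?f \<le> D"
      using ij by (intro degree_diff_le) (auto simp: degree_monom_eq)
    moreover have "mat_poly A ?f = 0" using ij(4) by (simp add: v_def flat_eq mat_poly_diff)
    ultimately show ?thesis using that[of ?f] by (simp add: D_def)
  next
    case True
    have "card (v ` {..D}) = Suc D" using card_image[OF True] by simp
    moreover have "vec.dim (UNIV :: ('a ^ ('n \<times> 'n)) set) = D"
      by (simp only: vec.dim_UNIV) (simp add: card_cart_basis D_def power2_eq_square)
    ultimately have "vec.dependent (v ` {..D})"
      using vec.independent_card_le_dim[of "v ` {..D}" UNIV] by fastforce
    then obtain u where u: "\<exists>x\<in>v ` {..D}. u x \<noteq> 0" "(\<Sum>x\<in>v ` {..D}. u x *s x) = 0"
      using vec.dependent_finite[of "v ` {..D}"] by auto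
    define f where "f = (\<Sum>i\<le>D. monom (u (v i)) i)"
    have cf: "coeff f i = (if i \<le> D then u (v i) else 0)" for i
      by (simp add: f_def coeff_sum)
    have "f \<noteq> 0" using u(1) cf by (metis (no_types, lifting) atMost_iff coeff_0 imageE)
    moreover have "degree f \<le> D" by (rule degree_le) (simp add: cf)
    moreover have "mat_poly A f = 0"
    proof -
      have "(\<Sum>i\<le>D. u (v i) *s v i) = 0" using u(2) by (simp add: sum.reindex[OF True])
      hence "(\<Sum>i\<le>D. u (v i) * mat_poly A (monom 1 i) $ a $ b) = 0" for a b
        by (drule_tac arg_cong[of _ _ "\<lambda>x. x $ (a, b)"]) (simp add: v_def flat_def)
      moreover have "mat_poly A f = (\<Sum>i\<le>D. mat (u (v i)) ** mat_poly A (monom 1 i))"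
        unfolding f_def mat_poly_sum by (simp add: smult_monom flip: mat_poly_smult)
      ultimately show ?thesis by (simp add: vec_eq_iff mat_mult_nth)
    qed
    ultimately show ?thesis using that by (auto simp: D_def)
  qed
qed

lemma mat_minimal_poly:
  fixes A :: "'a::field ^ 'n::finite ^ 'n"
  obtains f where "lead_coeff f = 1" "degree f \<le> CARD('n) ^ 2" "mat_poly A f = 0"
    "\<And>G. mat_poly A G = 0 \<Longrightarrow> f dvd G"
proof -
  define Q where "Q = (\<lambda>f. f \<noteq> 0 \<and> mat_poly A f = 0)"
  obtain f0 where f0: "Q f0" "degree f0 \<le> CARD('n) ^ 2"
    using mat_poly_annihilator[of A] unfolding Q_def by metis
  define f1 where "f1 = arg_min degree Q"
  have f1: "Q f1" "\<And>f. Q f \<Longrightarrow> degree f1 \<le> degree f"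
    unfolding f1_def using f0(1) by (auto intro: arg_min_natI arg_min_nat_le)
  define f where "f = smult (inverse (lead_coeff f1)) f1"
  have "f1 \<noteq> 0" using f1(1) by (simp add: Q_def)
  hence lead: "lead_coeff f = 1" and deg: "degree f = degree f1" by (auto simp: f_def)
  have ann: "mat_poly A f = 0" using f1(1) by (simp add: f_def mat_poly_smult Q_def)
  have "f dvd G" if "mat_poly A G = 0" for G
  proof (rule ccontr)
    assume "\<not> f dvd G"
    hence nz: "G mod f \<noteq> 0" by (simp add: mod_eq_0_iff_dvd)
    have "mat_poly A G = mat_poly A (f * (G div f)) + mat_poly A (G mod f)"
      by (simp only: mat_poly_add[symmetric] mult_div_mod_eq)
    hence "mat_poly A (G mod f) = 0" using that ann by (simp add: mat_poly_mult)
    hence "degree f \<le> degree (G mod f)" using nz f1(2) by (simp add: Q_def deg)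
    moreover have "degree (G mod f) < degree f"
      using nz lead by (intro degree_mod_less') auto
    ultimately show False by simp
  qed
  moreover have "degree f \<le> CARD('n) ^ 2" using deg f0 f1(2)[of f0] by simp
  ultimately show ?thesis using that lead ann by blast
qed

section \<open>The sup norm and a criterion for nilpotence\<close>

text \<open>Upper bounds for the sup norm, which is submultiplicative by the ultrametric inequality.\<close>

definition mat_bound :: "real \<Rightarrow> 'p::prime_card padic ^ 'n ^ 'n \<Rightarrow> bool" where
  "mat_bound c A \<longleftrightarrow> (\<forall>i j. padic_abs (A $ i $ j) \<le> c)"

lemma mat_bound_exists:
  fixes A :: "'p::prime_card padic ^ 'n::finite ^ 'n"
  obtains c where "c > 0" "mat_bound c A"
proof -
  define c where "c = 1 + (\<Sum>i\<in>UNIV. \<Sum>j\<in>UNIV. padic_abs (A $ i $ j))"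
  have "padic_abs (A $ i $ j) \<le> c" for i j
  proof -
    have "padic_abs (A $ i $ j) \<le> (\<Sum>j\<in>UNIV. padic_abs (A $ i $ j))"
      by (rule member_le_sum) auto
    also have "\<dots> \<le> (\<Sum>i\<in>UNIV. \<Sum>j\<in>UNIV. padic_abs (A $ i $ j))"
      by (rule member_le_sum[where f = "\<lambda>i. \<Sum>j\<in>UNIV. padic_abs (A $ i $ j)"]) (auto intro: sum_nonneg)
    finally show ?thesis by (simp add: c_def)
  qed
  moreover have "c > 0" unfolding c_def by (intro add_pos_nonneg sum_nonneg) auto
  ultimately show ?thesis using that by (auto simp: mat_bound_def)
qed

lemma mat_bound_nonneg: "mat_bound c A \<Longrightarrow> c \<ge> 0"
  unfolding mat_bound_def using padic_abs_nonneg order.trans by blast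

lemma mat_bound_mono: "mat_bound c A \<Longrightarrow> c \<le> d \<Longrightarrow> mat_bound d A"
  unfolding mat_bound_def using order.trans by blast

lemma mat_bound_mult:
  assumes "mat_bound c A" "mat_bound d B"
  shows "mat_bound (c * d) (A ** B)"
  unfolding mat_bound_def matrix_matrix_mult_def
  using assms mat_bound_nonneg[OF assms(1)] mat_bound_nonneg[OF assms(2)]
  by (auto simp: mat_bound_def padic_abs_mult intro!: padic_abs_sum_le mult_mono)

lemma mat_bound_mat: "mat_bound (padic_abs a) (mat a)"
  by (simp add: mat_bound_def mat_def padic_abs_0)

lemma mat_bound_sum:
  assumes "\<And>i. i \<in> I \<Longrightarrow> mat_bound c (A i)" "c \<ge> 0"
  shows "mat_bound c (sum A I)"
  using assms by (simp add: mat_bound_def padic_abs_sum_le)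

lemma mat_bound_power:
  assumes "mat_bound c A"
  shows "mat_bound (c ^ m) (mat_poly A (monom 1 m))"
proof (induction m)
  case 0
  show ?case using mat_bound_mat[of 1] by (simp add: monom_0)
next
  case (Suc m)
  show ?case using mat_bound_mult[OF Suc assms] by (simp add: mat_poly_monom_Suc mult.commute)
qed

text \<open>Integral combinations of finitely many powers of \<open>h\<close> form a bounded set.\<close>

lemma mat_poly_integral_bounded:
  fixes h :: "'p::prime_card padic ^ 'n::finite ^ 'n"
  obtains C where "\<And>u. integral_poly u \<Longrightarrow> degree u \<le> D \<Longrightarrow> mat_bound C (mat_poly h u)"
proof -
  have "\<forall>i. \<exists>c. c > 0 \<and> mat_bound c (mat_poly h (monom 1 i))" using mat_bound_exists by metis
  then obtain c where c: "\<And>i. c i > 0" "\<And>i. mat_bound (c i) (mat_poly h (monom 1 i))" by metis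
  have "mat_bound (\<Sum>i\<le>D. c i) (mat_poly h u)" if u: "integral_poly u" "degree u \<le> D" for u
  proof -
    have "mat_poly h u = mat_poly h (\<Sum>i\<le>D. smult (coeff u i) (monom 1 i))"
      using poly_as_sum_of_monoms'[OF u(2)] by (simp add: smult_monom)
    also have "\<dots> = (\<Sum>i\<le>D. mat (coeff u i) ** mat_poly h (monom 1 i))"
      by (simp only: mat_poly_sum mat_poly_smult)
    also have "mat_bound (\<Sum>i\<le>D. c i) \<dots>"
    proof (intro mat_bound_sum)
      fix i assume i: "i \<in> {..D}"
      have "padic_abs (coeff u i) * c i \<le> 1 * c i"
        using u(1) c(1)[of i] by (intro mult_right_mono) (auto simp: integral_poly_def)
      also have "\<dots> \<le> (\<Sum>i\<le>D. c i)"
        using i c(1) by (simp add: member_le_sum less_imp_le)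
      finally show "mat_bound (\<Sum>i\<le>D. c i) (mat (coeff u i) ** mat_poly h (monom 1 i))"
        using mat_bound_mult[OF mat_bound_mat c(2)] mat_bound_mono by blast
    qed (intro sum_nonneg less_imp_le c(1))
    finally show ?thesis .
  qed
  thus ?thesis using that by blast
qed

text \<open>A matrix of spectral radius \<open>0\<close> is nilpotent. On the Fitting component where \<open>B\<close> is invertible its
  inverse is a polynomial \<open>s\<close> in \<open>B\<close>, so the powers of \<open>B\<close> cannot decay faster there than the powers of
  the norm of \<open>s\<close> grow. Concretely, the \<open>e\<close>-th power of \<open>B\<close> absorbs \<open>B\<close> times \<open>s(B)\<close>, hence all powers of
  this product, and these tend to \<open>0\<close> in norm.\<close>

lemma mat_nilpotentI:
  fixes B :: "'p::prime_card padic ^ 'n::finite ^ 'n"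
  assumes bound: "\<And>e. e > 0 \<Longrightarrow> \<exists>C. \<forall>m. mat_bound (C * e ^ m) (mat_poly B (monom 1 m))"
  obtains e where "mat_poly B (monom 1 e) = 0"
proof -
  obtain P where P: "P \<noteq> 0" "mat_poly B P = 0" using mat_poly_annihilator[of B] by metis
  \<comment> \<open>The Fitting component where \<open>B\<close> is nilpotent is the kernel of the \<open>e\<close>-th power of \<open>B\<close>.\<close>
  define e where "e = Polynomial.order 0 P"
  obtain q where q: "P = monom 1 e * q" "\<not> [:- 0, 1:] dvd q"
    using order_decomp[OF P(1), of 0] by (auto simp: e_def monom_altdef)
  obtain q0 q' where qq: "q = pCons q0 q'" by (cases q)
  have q0: "q0 \<noteq> 0" using q(2) poly_eq_0_iff_dvd[of q 0] by (simp add: qq)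
  define s where "s = - smult (inverse q0) q'"
  have "smult (inverse q0) P = monom 1 e * (1 - monom 1 1 * s)"
    unfolding q(1) qq s_def using q0
    by (simp add: monom_Suc monom_0 one_pCons smult_add_right)
  hence step: "monom 1 e = monom 1 e * (monom 1 1 * s) + smult (inverse q0) P"
    by (simp add: algebra_simps)
  have ann: "mat_poly B (smult (inverse q0) P * r) = 0" for r
    by (simp add: mat_poly_mult mat_poly_smult P(2))
  have E: "mat_poly B (monom 1 e) = mat_poly B (monom 1 e * monom 1 m * s ^ m)" for m
  proof (induction m)
    case 0
    show ?case by (simp add: monom_0 one_pCons flip: one_pCons)
  next
    case (Suc m)
    have eq: "monom 1 e * (monom 1 m * s ^ m) = monom 1 e * monom 1 (Suc m) * s ^ Suc m
        + smult (inverse q0) P * (monom 1 m * s ^ m)"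
      by (subst step) (simp add: algebra_simps mult_monom)
    have "mat_poly B (monom 1 e) = mat_poly B (monom 1 e * (monom 1 m * s ^ m))"
      using Suc by (simp only: mult.assoc)
    also have "\<dots> = mat_poly B (monom 1 e * monom 1 (Suc m) * s ^ Suc m)"
      unfolding eq by (simp only: mat_poly_add ann add_0_right)
    finally show ?case .
  qed
  obtain c where c: "c > 0" "mat_bound c (mat_poly B (monom 1 e))" by (rule mat_bound_exists)
  obtain d where d: "d > 0" "mat_bound d (mat_poly B s)" by (rule mat_bound_exists)
  obtain C where C: "\<And>m. mat_bound (C * (1 / (2 * d)) ^ m) (mat_poly B (monom 1 m))"
    using bound[of "1 / (2 * d)"] d by auto
  have "mat_bound (c * (C * (1 / (2 * d)) ^ m) * d ^ m) (mat_poly B (monom 1 e))" for m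
    by (subst E[of m], unfold mat_poly_mult mat_poly_power)
       (intro mat_bound_mult c C mat_bound_power d)
  moreover have "c * (C * (1 / (2 * d)) ^ m) * d ^ m = c * C * (1 / 2) ^ m" for m
    using d by (simp add: power_mult_distrib power_divide)
  ultimately have le: "padic_abs (mat_poly B (monom 1 e) $ i $ j) \<le> c * C * (1 / 2) ^ m" for i j m
    by (simp add: mat_bound_def)
  have "(\<lambda>m. c * C * (1 / 2) ^ m) \<longlonglongrightarrow> c * C * 0"
    by (intro tendsto_intros LIMSEQ_realpow_zero) auto
  hence "padic_abs (mat_poly B (monom 1 e) $ i $ j) \<le> 0" for i j
    using le by (intro LIMSEQ_le_const) auto
  hence "mat_poly B (monom 1 e) = 0"
    by (simp add: vec_eq_iff) (metis padic_abs_eq_0_iff padic_abs_nonneg order_antisym)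
  thus ?thesis using that by blast
qed

section \<open>Matrices with roots of all orders\<close>

lemma invertible_mult_eq_0D: "invertible A \<Longrightarrow> A ** Z = 0 \<Longrightarrow> Z = 0"
  for A Z :: "'a::comm_ring_1 ^ 'n::finite ^ 'n"
  unfolding invertible_def by (metis matrix_mul_assoc matrix_mul_lid times0_right)

lemma invertible_mat_poly_monom: "invertible A \<Longrightarrow> invertible (mat_poly A (monom 1 k))"
  for A :: "'a::comm_ring_1 ^ 'n::finite ^ 'n"
  by (induction k) (auto simp: monom_0 mat_poly_monom_Suc invertible_mult invertible_def[of "mat 1"] intro!: exI[of _ "mat 1"])

text \<open>For a suitable \<open>k\<close>, the minimal polynomial \<open>f\<close> of a \<open>k\<close>-th root \<open>h\<close> of \<open>g\<close> is integral and \<open>x ^ k\<close> is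
  idempotent modulo \<open>p ^ (s + 1)\<close> and \<open>f\<close>. Evaluated at \<open>h\<close> this gives \<open>B = c * w(h)\<close>, where \<open>B\<close> is the square
  of \<open>g\<close> minus \<open>g\<close>, \<open>c = p ^ (s + 1)\<close> and \<open>w\<close> is integral. The \<open>j\<close>-th power of \<open>B\<close> is therefore \<open>c ^ j\<close> times
  an element of the bounded set of integral polynomials in \<open>h\<close> of degree at most \<open>n\<^sup>2\<close>. The bound depends
  on \<open>h\<close>, hence on \<open>s\<close>, but not on \<open>j\<close>; as \<open>s\<close> is arbitrary, \<open>B\<close> has spectral radius \<open>0\<close> and is
  nilpotent. Since \<open>g\<close> is invertible, \<open>g - 1\<close> is nilpotent as well.\<close>

proposition roots_imp_unipotent:
  fixes g :: "'p::prime_card padic ^ 'n::finite ^ 'n"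
  assumes inv: "invertible g"
    and roots: "\<And>k. k \<ge> 1 \<Longrightarrow> \<exists>h. mat_poly h (monom 1 k) = g"
  shows "\<exists>e. mat_poly (g - mat 1) (monom 1 e) = 0"
proof -
  let ?p = "CARD('p)"
  define D where "D = CARD('n) ^ 2"
  have p1: "real ?p > 1" using prime_card_gt_1[where 'p='p] by simp
  obtain G where G: "lead_coeff G = 1" "mat_poly g G = 0" using mat_minimal_poly[of g] by metis
  define b where "b = (\<Sum>i\<le>degree G. padic_abs (coeff G i))"
  have b: "padic_abs (coeff G i) \<le> b" for i
  proof (cases "i \<le> degree G")
    case True
    thus ?thesis unfolding b_def by (intro member_le_sum) auto
  next
    case False
    thus ?thesis unfolding b_def by (simp add: coeff_eq_0 padic_abs_0 sum_nonneg)
  qed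
  obtain m where m: "real ?p ^ m > b" using real_arch_pow[OF p1] by blast
  define B where "B = mat_poly g (monom 1 2 - monom 1 1)"
  have "\<exists>C. \<forall>j. mat_bound (C * e ^ j) (mat_poly B (monom 1 j))" if "e > 0" for e
  proof -
    obtain s where s: "(1 / real ?p) ^ s < e" using real_arch_pow_inv[OF \<open>e > 0\<close>, of "1 / real ?p"] p1 by auto
    \<comment> \<open>The factor \<open>Suc (D * m)\<close> makes \<open>k\<close> large enough for integrality, the other two make \<open>x ^ k\<close> idempotent.\<close>
    define k where "k = fact (?p ^ D) * Suc (D * m) * ?p ^ s"
    have "1 \<le> (fact (?p ^ D) :: nat)" "1 \<le> ?p ^ s" using p1 by auto
    hence "D * m < k" unfolding k_def
      by (metis (no_types, lifting) less_eq_Suc_le mult.right_neutral mult.left_neutral mult_le_mono order.refl)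
    hence k: "k \<ge> D * m" "k > 0" by auto
    then obtain h where h: "mat_poly h (monom 1 k) = g" using roots[of k] by auto
    obtain f where f: "lead_coeff f = 1" "degree f \<le> D" "mat_poly h f = 0"
      and fdvd: "\<And>G. mat_poly h G = 0 \<Longrightarrow> f dvd G"
      using mat_minimal_poly[of h] unfolding D_def by metis
    have "f dvd pcompose G (monom 1 k)" by (rule fdvd) (simp add: mat_poly_pcompose h G)
    hence int: "integral_poly f"
      by (intro integral_poly_of_dvd_pcompose_monom[OF f(1,2) G(1) b k m])
    have "congruent_mod f (Suc s) (monom 1 (2 * k)) (monom 1 k)"
      by (rule monom_power_idempotent_mod[OF int f(1,2) k_def]) simp
    then obtain w q where w: "integral_poly w"
        "monom 1 (2 * k) = monom 1 k + smult (of_nat ?p ^ Suc s) w + f * q"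
      unfolding congruent_mod_def by blast
    define c :: "'p padic" where "c = of_nat ?p ^ Suc s"
    have "padic_abs c = (1 / real ?p) ^ Suc s" by (simp only: c_def padic_abs_power padic_abs_prime)
    also have "\<dots> \<le> (1 / real ?p) ^ s" using p1 by (intro power_decreasing) auto
    finally have c: "padic_abs c \<le> e" using s by simp
    have "B = mat_poly h (monom 1 (2 * k) - monom 1 k)"
      unfolding B_def by (simp add: mat_poly_diff mat_poly_pcompose[symmetric] pcompose_monom monom_power mult.commute[of k 2] flip: h mat_poly_power)
    also have "\<dots> = mat_poly h (smult c w)"
      unfolding w(2) by (simp add: mat_poly_add mat_poly_diff mat_poly_mult f c_def)
    finally have Bw: "B = mat_poly h (smult c w)" .
    obtain C where C: "\<And>u. integral_poly u \<Longrightarrow> degree u \<le> D \<Longrightarrow> mat_bound C (mat_poly h u)"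
      using mat_poly_integral_bounded by blast
    have C0: "C \<ge> 0" using C[of 0] mat_bound_nonneg by auto
    have "mat_bound (C * e ^ j) (mat_poly B (monom 1 j))" for j
    proof -
      have wj: "mat_poly h (w ^ j) = mat_poly h (w ^ j mod f)"
      proof -
        have "mat_poly h (w ^ j) = mat_poly h (f * (w ^ j div f) + w ^ j mod f)" by simp
        thus ?thesis by (simp only: mat_poly_add mat_poly_mult f) simp
      qed
      have deg: "degree (w ^ j mod f) \<le> D"
      proof (cases "w ^ j mod f = 0")
        case False
        have "f \<noteq> 0" using f(1) by auto
        thus ?thesis using False f(2) degree_mod_less[of f "w ^ j"] by linarith
      qed simp
      have "mat_poly B (monom 1 j) = mat (c ^ j) ** mat_poly h (w ^ j mod f)"
        unfolding Bw mat_poly_power[symmetric] by (simp add: smult_power mat_poly_smult wj)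
      also have "mat_bound (padic_abs (c ^ j) * C) \<dots>"
        by (intro mat_bound_mult mat_bound_mat C deg integral_poly_mod int f integral_poly_power w)
      finally have "mat_bound (padic_abs (c ^ j) * C) (mat_poly B (monom 1 j))" .
      moreover have "padic_abs (c ^ j) * C \<le> C * e ^ j"
        using c C0 by (simp add: padic_abs_power mult.commute mult_left_mono power_mono)
      ultimately show ?thesis by (rule mat_bound_mono)
    qed
    thus ?thesis by blast
  qed
  then obtain e where "mat_poly B (monom 1 e) = 0" using mat_nilpotentI by blast
  hence zero: "mat_poly g ((monom 1 2 - monom 1 1) ^ e) = 0" unfolding B_def mat_poly_power .
  have factor: "(monom 1 2 - monom 1 1) ^ e = monom 1 e * (monom 1 1 - (1 :: 'p padic poly)) ^ e"
  proof -
    have "monom 1 2 - monom 1 1 = monom 1 1 * (monom 1 1 - (1 :: 'p padic poly))"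
      by (simp add: algebra_simps mult_monom numeral_2_eq_2)
    thus ?thesis by (simp add: power_mult_distrib monom_power)
  qed
  have "mat_poly g (monom 1 e) ** mat_poly (g - mat 1) (monom 1 e) = 0"
    using zero[unfolded factor]
    by (simp only: mat_poly_mult mat_poly_power mat_poly_diff mat_poly_X mat_poly_1 One_nat_def)
  thus ?thesis using invertible_mult_eq_0D[OF invertible_mat_poly_monom[OF inv]] by blast
qed

section \<open>Rational points\<close>

lemma map_matrix_to_ac_mult:
  "map_matrix to_ac (A ** B) = map_matrix to_ac A ** map_matrix to_ac B"
  for A B :: "'k::field ^ 'n::finite ^ 'n"
  by (simp add: vec_eq_iff matrix_matrix_mult_def to_ac_sum)

lemma map_matrix_to_ac_mat: "map_matrix to_ac (mat 1) = mat 1"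
  by (simp add: vec_eq_iff mat_def)

lemma eval_entry_poly_to_ac:
  "eval_entry_poly to_ac (map_matrix to_ac A) f = to_ac (eval_entry_poly (\<lambda>c. c) A f)"
  by (simp add: eval_entry_poly_def to_ac_sum to_ac_prod case_prod_beta)

text \<open>The group axioms are assumed for the points over the algebraic closure only. This equivalence
  transports them to the rational points.\<close>

lemma rational_points_iff_to_ac:
  assumes "invertible A"
  shows "A \<in> rational_points P \<longleftrightarrow> map_matrix to_ac A \<in> points_over to_ac P"
proof -
  obtain B where "A ** B = mat 1" "B ** A = mat 1" using assms unfolding invertible_def by blast
  hence "invertible (map_matrix to_ac A)"
    unfolding invertible_def by (metis map_matrix_to_ac_mult map_matrix_to_ac_mat)
  thus ?thesis using assms by (simp add: points_over_def eval_entry_poly_to_ac)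
qed

lemma rational_points_power:
  assumes P: "linear_algebraic_group P" and g: "g \<in> rational_points P"
  shows "mat_poly g (monom 1 k) \<in> rational_points P"
proof -
  interpret subgroup "points_over to_ac P" GL
    using P by (simp add: linear_algebraic_group_def)
  have inv: "invertible g" using g by (simp add: points_over_def)
  have "map_matrix to_ac (mat_poly g (monom 1 k)) \<in> points_over to_ac P"
  proof (induction k)
    case 0
    show ?case using one_closed by (simp add: monom_0 map_matrix_to_ac_mat GL_def flip: one_pCons)
  next
    case (Suc k)
    have "map_matrix to_ac g \<in> points_over to_ac P"
      using g rational_points_iff_to_ac[OF inv] by blast
    from m_closed[OF Suc this] show ?case
      by (simp add: mat_poly_monom_Suc map_matrix_to_ac_mult GL_def)
  qed
  thus ?thesis using rational_points_iff_to_ac[OF invertible_mat_poly_monom[OF inv]] by blast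
qed

section \<open>Polynomial functions\<close>

text \<open>Functions given by polynomials, as a predicate that is closed under the operations occurring in matrix
  entries. It serves twice: such a function is continuous, and it vanishes identically if it vanishes at
  all natural numbers, because these form an infinite set in characteristic \<open>0\<close>.\<close>

definition polynomial_fun :: "('a::comm_ring_1 \<Rightarrow> 'a) \<Rightarrow> bool" where
  "polynomial_fun F \<longleftrightarrow> (\<exists>Q. \<forall>t. F t = poly Q t)"

named_theorems polynomial_fun_intros

lemma polynomial_fun_const [polynomial_fun_intros]: "polynomial_fun (\<lambda>_. c)"
  unfolding polynomial_fun_def by (intro exI[of _ "[:c:]"]) simp

lemma polynomial_fun_id [polynomial_fun_intros]: "polynomial_fun (\<lambda>t. t)"
  unfolding polynomial_fun_def by (intro exI[of _ "[:0, 1:]"]) simp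

lemma polynomial_fun_diff [polynomial_fun_intros]:
  "polynomial_fun F \<Longrightarrow> polynomial_fun G \<Longrightarrow> polynomial_fun (\<lambda>t. F t - G t)"
  unfolding polynomial_fun_def by (metis poly_diff)

lemma polynomial_fun_mult [polynomial_fun_intros]:
  "polynomial_fun F \<Longrightarrow> polynomial_fun G \<Longrightarrow> polynomial_fun (\<lambda>t. F t * G t)"
  unfolding polynomial_fun_def by (metis poly_mult)

lemma polynomial_fun_add [polynomial_fun_intros]:
  "polynomial_fun F \<Longrightarrow> polynomial_fun G \<Longrightarrow> polynomial_fun (\<lambda>t. F t + G t)"
  unfolding polynomial_fun_def by (metis poly_add)

lemma polynomial_fun_power [polynomial_fun_intros]:
  "polynomial_fun F \<Longrightarrow> polynomial_fun (\<lambda>t. F t ^ n)"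
  unfolding polynomial_fun_def by (metis poly_power)

lemma polynomial_fun_sum [polynomial_fun_intros]:
  "(\<And>i. i \<in> I \<Longrightarrow> polynomial_fun (F i)) \<Longrightarrow> polynomial_fun (\<lambda>t. \<Sum>i\<in>I. F i t)"
  by (induction I rule: infinite_finite_induct) (auto intro: polynomial_fun_intros)

lemma polynomial_fun_prod [polynomial_fun_intros]:
  "(\<And>i. i \<in> I \<Longrightarrow> polynomial_fun (F i)) \<Longrightarrow> polynomial_fun (\<lambda>t. \<Prod>i\<in>I. F i t)"
  by (induction I rule: infinite_finite_induct) (auto intro: polynomial_fun_intros)

lemma polynomial_fun_gchoose [polynomial_fun_intros]:
  "polynomial_fun (\<lambda>t :: 'a::field_char_0. t gchoose j)"
  unfolding gbinomial_prod_rev divide_inverse by (intro polynomial_fun_intros)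

lemma polynomial_fun_eval_entry_poly:
  assumes "\<And>a b. polynomial_fun (\<lambda>t. A t $ a $ b)"
  shows "polynomial_fun (\<lambda>t. eval_entry_poly (\<lambda>c. c) (A t) f)"
  unfolding eval_entry_poly_def case_prod_beta by (intro polynomial_fun_intros assms)

lemma polynomial_fun_eq_0I:
  fixes F :: "'a::field_char_0 \<Rightarrow> 'a"
  assumes "polynomial_fun F" "\<And>k. F (of_nat k) = 0"
  shows "F t = 0"
proof -
  obtain Q where Q: "\<And>t. F t = poly Q t" using assms(1) unfolding polynomial_fun_def by blast
  have "Q = 0"
  proof (rule ccontr)
    assume "Q \<noteq> 0"
    hence "finite {t. poly Q t = 0}" by (rule poly_roots_finite)
    moreover have "range of_nat \<subseteq> {t. poly Q t = 0}" using assms(2) Q by auto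
    ultimately have "finite (range (of_nat :: nat \<Rightarrow> 'a))" by (rule rev_finite_subset)
    thus False using range_inj_infinite[OF inj_of_nat] by blast
  qed
  thus ?thesis by (simp add: Q)
qed

lemma polynomial_fun_continuous:
  fixes F :: "'p::prime_card padic \<Rightarrow> 'p padic"
  assumes "polynomial_fun F"
  shows "continuous_on UNIV F"
proof -
  obtain Q where Q: "\<And>t. F t = poly Q t" using assms unfolding polynomial_fun_def by blast
  have "continuous_on UNIV (poly Q)"
    by (induction Q) (auto intro!: continuous_on_add continuous_on_mult' continuous_on_id continuous_on_const)
  moreover have "F = poly Q" using Q by auto
  ultimately show ?thesis by simp
qed

section \<open>The one-parameter subgroup through a unipotent element\<close>

definition binomial_poly :: "nat \<Rightarrow> 'a::field_char_0 \<Rightarrow> 'a poly" where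
  "binomial_poly m t = (\<Sum>j<m. monom (t gchoose j) j)"

lemma coeff_binomial_poly: "coeff (binomial_poly m t) j = (if j < m then t gchoose j else 0)"
  by (simp add: binomial_poly_def coeff_sum)

text \<open>The binomial series for the power of \<open>g\<close> with exponent \<open>t\<close>, in powers of the nilpotent matrix \<open>g - 1\<close>. It
  equals the exponential of \<open>t\<close> times the logarithm of \<open>g\<close>, but its addition law is Vandermonde's identity
  and its values at natural numbers are visibly the powers of \<open>g\<close>.\<close>

definition unipotent_power :: "nat \<Rightarrow> 'a::field_char_0 ^ 'n ^ 'n \<Rightarrow> 'a \<Rightarrow> 'a ^ 'n ^ 'n" where
  "unipotent_power m g t = mat_poly (g - mat 1) (binomial_poly m t)"

lemma unipotent_power_add:
  fixes g :: "'a::field_char_0 ^ 'n::finite ^ 'n"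
  assumes "mat_poly (g - mat 1) (monom 1 m) = 0"
  shows "unipotent_power m g (s + t) = unipotent_power m g s ** unipotent_power m g t"
proof -
  \<comment> \<open>By Vandermonde the truncated series multiply correctly up to terms of degree at least \<open>m\<close>,
    which vanish at \<open>g - 1\<close>.\<close>
  let ?d = "binomial_poly m s * binomial_poly m t - binomial_poly m (s + t)"
  have "coeff ?d i = 0" if "i < m" for i
    using that gbinomial_Vandermonde[of s t i]
    by (simp add: coeff_mult coeff_binomial_poly atMost_atLeast0 less_imp_diff_less)
  hence "monom 1 m dvd ?d" by (simp add: monom_1_dvd_iff')
  then obtain q where "?d = monom 1 m * q" by (elim dvdE)
  hence "mat_poly (g - mat 1) ?d = 0" using assms by (simp add: mat_poly_mult)
  thus ?thesis by (simp add: unipotent_power_def mat_poly_diff mat_poly_mult)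
qed

lemma unipotent_power_0: "m > 0 \<Longrightarrow> unipotent_power m g 0 = mat 1"
proof -
  assume "m > 0"
  hence "binomial_poly m (0 :: 'a) = 1"
    by (intro poly_eqI) (simp add: coeff_binomial_poly gbinomial_0_left)
  thus ?thesis by (simp add: unipotent_power_def)
qed

lemma unipotent_power_1:
  assumes "m > 1"
  shows "unipotent_power m g 1 = (g :: 'a::field_char_0 ^ 'n::finite ^ 'n)"
proof -
  have "(1 :: 'a) gchoose j = of_nat (1 choose j)" for j
    using binomial_gbinomial[of 1 j, where 'a='a] by simp
  hence "binomial_poly m (1 :: 'a) = 1 + monom 1 (Suc 0)"
    using assms by (intro poly_eqI) (auto simp: coeff_binomial_poly binomial_eq_0 le_Suc_eq not_le)
  thus ?thesis by (simp add: unipotent_power_def mat_poly_add)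
qed

lemma unipotent_power_of_nat:
  fixes g :: "'a::field_char_0 ^ 'n::finite ^ 'n"
  assumes "mat_poly (g - mat 1) (monom 1 m) = 0" "m > 1"
  shows "unipotent_power m g (of_nat k) = mat_poly g (monom 1 k)"
proof (induction k)
  case 0
  show ?case using assms(2) by (simp add: unipotent_power_0 monom_0 flip: one_pCons)
next
  case (Suc k)
  have "unipotent_power m g (of_nat k + 1) = mat_poly g (monom 1 k) ** g"
    unfolding unipotent_power_add[OF assms(1)] Suc unipotent_power_1[OF assms(2)] ..
  thus ?case by (simp add: mat_poly_monom_Suc add.commute)
qed

lemma polynomial_fun_unipotent_power:
  fixes g :: "'a::field_char_0 ^ 'n::finite ^ 'n"
  shows "polynomial_fun (\<lambda>t. unipotent_power m g t $ a $ b)"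
proof -
  have "unipotent_power m g t = (\<Sum>j<m. mat (t gchoose j) ** mat_poly (g - mat 1) (monom 1 j))" for t
    unfolding unipotent_power_def binomial_poly_def mat_poly_sum
    by (simp add: smult_monom flip: mat_poly_smult)
  thus ?thesis by (simp add: mat_mult_nth polynomial_fun_intros)
qed

text \<open>The group is cut out by polynomial equations, and along this subgroup they become polynomial functions
  of \<open>t\<close>. They vanish at natural numbers, where the values are powers of \<open>g\<close>, hence everywhere.\<close>

lemma one_parameter_subgroup_unipotent_power:
  fixes g :: "'p::prime_card padic ^ 'n::finite ^ 'n"
  assumes P: "linear_algebraic_group P" and g: "g \<in> rational_points P"
    and m: "mat_poly (g - mat 1) (monom 1 m) = 0" "m > 1"
  shows "one_parameter_subgroup P (unipotent_power m g)"
  unfolding one_parameter_subgroup_def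
proof (intro conjI allI)
  show "continuous_on UNIV (unipotent_power m g)"
  proof -
    have "continuous_on UNIV (\<lambda>t. \<chi> a b. unipotent_power m g t $ a $ b)"
      by (intro continuous_on_vec_lambda polynomial_fun_continuous polynomial_fun_unipotent_power)
    thus ?thesis by simp
  qed
  show "unipotent_power m g (s + t) = unipotent_power m g s ** unipotent_power m g t" for s t
    by (rule unipotent_power_add[OF m(1)])
  show "range (unipotent_power m g) \<subseteq> rational_points P"
  proof clarify
    fix t
    have "unipotent_power m g s ** unipotent_power m g (- s) = mat 1" for s
      using unipotent_power_add[OF m(1), of s "- s"] m(2) by (simp add: unipotent_power_0)
    from this[of t] this[of "- t"] have "invertible (unipotent_power m g t)"
      unfolding invertible_def by auto
    moreover have "eval_entry_poly (\<lambda>c. c) (unipotent_power m g t) f = 0" if "f \<in> P" for f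
    proof (rule polynomial_fun_eq_0I[where F = "\<lambda>t. eval_entry_poly (\<lambda>c. c) (unipotent_power m g t) f"])
      show "polynomial_fun (\<lambda>t. eval_entry_poly (\<lambda>c. c) (unipotent_power m g t) f)"
        by (intro polynomial_fun_eval_entry_poly polynomial_fun_unipotent_power)
      show "eval_entry_poly (\<lambda>c. c) (unipotent_power m g (of_nat k)) f = 0" for k
        using rational_points_power[OF P g, of k] that
        by (simp add: unipotent_power_of_nat[OF m] points_over_def)
    qed
    ultimately show "unipotent_power m g t \<in> rational_points P" by (simp add: points_over_def)
  qed
qed

lemma one_parameter_subgroup_of_nat:
  assumes "one_parameter_subgroup P \<Phi>"
  shows "\<Phi> (of_nat k * s) = mat_poly (\<Phi> s) (monom 1 k)"
proof (induction k)
  case 0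
  have "invertible (\<Phi> 0)"
    using assms by (auto simp: one_parameter_subgroup_def points_over_def)
  moreover have "\<Phi> 0 ** \<Phi> 0 = \<Phi> 0"
    using assms unfolding one_parameter_subgroup_def by (metis add_0)
  ultimately have "\<Phi> 0 = mat 1"
    unfolding invertible_def by (metis matrix_mul_assoc matrix_mul_lid)
  thus ?case by (simp add: monom_0 flip: one_pCons)
next
  case (Suc k)
  have "\<Phi> (of_nat k * s + s) = \<Phi> (of_nat k * s) ** \<Phi> s"
    using assms by (simp add: one_parameter_subgroup_def)
  moreover have "of_nat (Suc k) * s = of_nat k * s + s" by (simp add: algebra_simps)
  ultimately show ?case by (simp only: Suc mat_poly_monom_Suc)
qed

section \<open>The three conditions are equivalent\<close>

theorem corollary3p4:
  fixes P :: "('p::prime_card padic, 'n::finite) entry_poly set"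
    and g :: "'p padic ^ 'n ^ 'n"
  assumes "linear_algebraic_group P"
    and "g \<in> rational_points P"
  shows "((\<forall>k::nat. k \<ge> 1 \<longrightarrow> (\<exists>h\<in>rational_points P. h [^]\<^bsub>GL\<^esub> k = g)) \<longleftrightarrow> unipotent g)
       \<and> (unipotent g \<longleftrightarrow> (\<exists>\<Phi>. one_parameter_subgroup P \<Phi> \<and> g \<in> range \<Phi>))"
proof -
  have inv: "invertible g" using assms(2) by (simp add: points_over_def)
  have i_ii: "unipotent g" if "\<forall>k::nat. k \<ge> 1 \<longrightarrow> (\<exists>h\<in>rational_points P. h [^]\<^bsub>GL\<^esub> k = g)"
    using roots_imp_unipotent[OF inv] that unfolding unipotent_def nat_pow_eq_mat_poly by blast
  have ii_iii: "\<exists>\<Phi>. one_parameter_subgroup P \<Phi> \<and> g \<in> range \<Phi>" if "unipotent g"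
  proof -
    obtain m where "mat_poly (g - mat 1) (monom 1 m) = 0"
      using \<open>unipotent g\<close> unfolding unipotent_def nat_pow_eq_mat_poly by blast
    \<comment> \<open>The truncation degree must exceed \<open>1\<close> for the series to take the value \<open>g\<close> at \<open>1\<close>.\<close>
    hence m: "mat_poly (g - mat 1) (monom 1 (Suc (Suc m))) = 0" by (simp add: mat_poly_monom_Suc)
    hence "one_parameter_subgroup P (unipotent_power (Suc (Suc m)) g)"
      using assms by (intro one_parameter_subgroup_unipotent_power) auto
    moreover have "g = unipotent_power (Suc (Suc m)) g 1" by (simp add: unipotent_power_1)
    ultimately show ?thesis by blast
  qed
  have iii_i: "\<exists>h\<in>rational_points P. h [^]\<^bsub>GL\<^esub> k = g"
    if \<Phi>: "one_parameter_subgroup P \<Phi>" "g \<in> range \<Phi>" and k: "k \<ge> 1" for \<Phi> and k :: nat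
  proof -
    obtain t where t: "g = \<Phi> t" using \<Phi>(2) by blast
    have "of_nat k * (t / of_nat k) = t" using k by simp
    hence "\<Phi> (t / of_nat k) [^]\<^bsub>GL\<^esub> k = g"
      using one_parameter_subgroup_of_nat[OF \<Phi>(1), of k "t / of_nat k"]
      by (simp add: nat_pow_eq_mat_poly t)
    thus ?thesis using \<Phi>(1) unfolding one_parameter_subgroup_def by blast
  qed
  show ?thesis using i_ii ii_iii iii_i by blast
qed

end
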